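(* Let $h(x)=e^x-1$. Define $$\alpha^{(1)}_{\mathrm W}(z)=\lim_{n\to\infty}\left(-\tfrac13\log n-\frac{2}{h^{[n]}(z)}-n\right)\quad (z<0),$$ $$\alpha^{(2)}_{\mathrm W}(z)=\lim_{n\to\infty}\left(-\tfrac13\log n-\frac{2}{h^{[-n]}(z)}+n\right)\quad (z>0),$$ where $z$ is real. Then $\alpha^{(1)}_{\mathrm W}$ and $\alpha^{(2)}_{\mathrm W}$ are the two regular Abel functions of $h$ at its fixed point $0$, where Abel functions differing by an additive constant are identified. That is, $\alpha^{(1)}_{\mathrm W}$ is, up to an additive constant, the regular Abel function of $h$ on $(-\infty,0)$, and $\alpha^{(2)}_{\mathrm W}$ is, up to an additive constant, the regular Abel function of $h$ on $(0,\infty)$.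
   Context: Iterates: for an integer $n\ge 0$, $h^{[n]}$ is the $n$-fold composition of $h$ with itself, and $h^{[-n]}$ is the $n$-fold composition of the inverse $h^{-1}(x)=\log(1+x)$. Abel function: a function $\alpha$ is an Abel function of $h$ if $\alpha(h(z))=\alpha(z)+1$. Formal regular iteration: for $h(z)=z+\sum_{n\ge m}h_nz^n$ with $m\ge 2$, $h_m\ne 0$ (here $m=2$, $h_2=1/2$) and each $t\in\mathbb C$, there is exactly one formal power series $h^{[t]}(z)=z+\sum_{n\ge m}(h^{[t]})_n z^n$ with $(h^{[t]})_m=t\,h_m$ and $h^{[t]}\circ h=h\circ h^{[t]}$. It satisfies $h^{[1]}=h$ and $h^{[s+t]}=h^{[s]}\circ h^{[t]}$. It need not converge. Regular iteration, superfunction, Abel function: a function that has the formal power series $h^{[t]}$ as its asymptotic expansion at $0$ is called a regular iteration of $h$, and is again denoted $h^{[t]}$. If $z\mapsto h^{[t]}(z)$ is analytic in some domain, then for $z_0$ in that domain the function $\sigma(t)=h^{[t]}(z_0)$ is called a regular superfunction of $h$, and its inverse $\alpha=\sigma^{-1}$ is called a regular Abel function of $h$; thus $h^{[t]}(z)=\sigma(t+\alpha(z))$. Abel functions that differ only by an additive constant are identified. The two regular Abel functions: by a known theorem of Écalle, $h(x)=e^x-1$ has exactly two regular Abel functions at $0$ (one for each petal at the fixed point $0$). Up to additive constants, and for any choice of $N\in\mathbb N$, they are $$\alpha^{(1)}(z)=\lim_{n\to\infty}\left(\tfrac13\log(-h^{[n]}(z))-\frac{2}{h^{[n]}(z)}+v_N(h^{[n]}(z))-n\right),\quad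 \Re z<0,$$ $$\alpha^{(2)}(z)=\lim_{n\to\infty}\left(\tfrac13\log(h^{[-n]}(z))-\frac{2}{h^{[-n]}(z)}+v_N(h^{[-n]}(z))+n\right),\quad \Re z>0.$$ Here $v_N$ is the truncation to $N$ summands of the formal power series $v(x)=-\frac1{36}x+\frac1{540}x^2+\frac1{7776}x^3-\frac{71}{435456}x^4+\cdots$, defined as follows. Let $j(x)=\sum_{k\ge2}j_kx^k$ be the unique formal power series with $j_2=\frac12$ and $j(h(x))=h'(x)\,j(x)$. Write $1/j(x)=2x^{-2}+\frac13x^{-1}+w(x)$ with $w$ a formal power series in $x$; then $v$ is the formal antiderivative of $w$ with zero constant term. *)

theory Defs
  imports "HOL-Complex_Analysis.Complex_Analysis"
begin

subsection \<open>The map and its real iterates\<close>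

definition h :: "'a::{banach, real_normed_field} \<Rightarrow> 'a" where
  "h x = exp x - 1"

definition h_inv :: "real \<Rightarrow> real" where
  "h_inv x = ln (1 + x)"

definition \<alpha>W1_seq :: "real \<Rightarrow> nat \<Rightarrow> real" where
  "\<alpha>W1_seq z n = - (1/3) * ln (real n) - 2 / (h ^^ n) z - real n"

definition \<alpha>W2_seq :: "real \<Rightarrow> nat \<Rightarrow> real" where
  "\<alpha>W2_seq z n = - (1/3) * ln (real n) - 2 / (h_inv ^^ n) z + real n"

definition \<alpha>W1 :: "real \<Rightarrow> real" where
  "\<alpha>W1 z = lim (\<alpha>W1_seq z)"

definition \<alpha>W2 :: "real \<Rightarrow> real" where
  "\<alpha>W2 z = lim (\<alpha>W2_seq z)"


subsection \<open>Regular iteration at the fixed point 0\<close>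

text \<open>
  \<open>H\<close> stands for \<open>z + H\<^sub>m z\<^sup>m + \<dots>\<close> with \<open>m \<ge> 2\<close> and \<open>H\<^sub>m \<noteq> 0\<close>, so that \<open>m\<close> is
  the subdegree of \<open>H - z\<close>. For such \<open>H\<close> and every \<open>t\<close> exactly one \<open>F\<close> satisfies
  the predicate below, namely the formal regular iterate \<open>H\<^bsup>[t]\<^esup>\<close>.
\<close>

definition formal_regular_iterate :: "complex fps \<Rightarrow> complex \<Rightarrow> complex fps \<Rightarrow> bool" where
  "formal_regular_iterate H t F \<longleftrightarrow>
     (let m = subdegree (H - fps_X) in
       (\<forall>n<m. fps_nth F n = fps_nth fps_X n) \<and> fps_nth F m = t * fps_nth H m) \<and>
     F oo H = H oo F"

text \<open>
  Asymptotic expansion in the sense of Poincare as \<open>z \<rightarrow> 0\<close> inside \<open>S\<close>. The power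
  series need not converge. Callers have to make sure that \<open>0\<close> is a limit point of
  \<open>S\<close>; otherwise the condition is void.
\<close>

definition has_asymp_expansion :: "(complex \<Rightarrow> complex) \<Rightarrow> complex fps \<Rightarrow> complex set \<Rightarrow> bool" where
  "has_asymp_expansion f F S \<longleftrightarrow>
     (\<forall>N. (\<lambda>z. f z - (\<Sum>n\<le>N. fps_nth F n * z ^ n)) \<in> o[at 0 within S](\<lambda>z. z ^ N))"

definition regular_iteration ::
  "(complex \<Rightarrow> complex) \<Rightarrow> complex \<Rightarrow> (complex \<Rightarrow> complex) \<Rightarrow> complex set \<Rightarrow> bool" where
  "regular_iteration g t f S \<longleftrightarrow>
     open S \<and> 0 islimpt S \<and> f holomorphic_on S \<and>
     (\<exists>F. formal_regular_iterate (fps_expansion g 0) t F \<and> has_asymp_expansion f F S)"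

text \<open>
  Here \<open>\<sigma>\<close> is the inverse of \<open>\<alpha>\<close> on the domain \<open>D\<close>, and the regular iterations are
  \<open>g\<^bsup>[t]\<^esup>(z) = \<sigma>(t + \<alpha>(z))\<close>, each considered at all points \<open>z\<close> of \<open>D\<close> where the right-hand
  side is meaningful. For a base point \<open>z\<^sub>0 \<in> D\<close>, the regular superfunction
  \<open>t \<mapsto> g\<^bsup>[t]\<^esup>(z\<^sub>0) = \<sigma>(t + \<alpha>(z\<^sub>0))\<close> therefore has the inverse \<open>\<alpha> - \<alpha>(z\<^sub>0)\<close>; a change of
  base point changes \<open>\<alpha>\<close> by an additive constant, and the predicate is invariant
  under such changes.
\<close>

definition regular_abel_function ::
  "(complex \<Rightarrow> complex) \<Rightarrow> complex set \<Rightarrow> (complex \<Rightarrow> complex) \<Rightarrow> bool" where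
  "regular_abel_function g D \<alpha> \<longleftrightarrow>
     open D \<and> connected D \<and> \<alpha> holomorphic_on D \<and> inj_on \<alpha> D \<and>
     (\<forall>z\<in>D. g z \<in> D \<longrightarrow> \<alpha> (g z) = \<alpha> z + 1) \<and>
     (let \<sigma> = inv_into D \<alpha> in
       \<forall>t. regular_iteration g t (\<lambda>z. \<sigma> (t + \<alpha> z)) {z\<in>D. t + \<alpha> z \<in> \<alpha> ` D})"

text \<open>
  A real function on a set \<open>I\<close> of reals is a regular Abel function if it is the restriction
  of one on a complex domain containing \<open>I\<close>.
\<close>

definition regular_abel_function_real ::
  "(complex \<Rightarrow> complex) \<Rightarrow> real set \<Rightarrow> (real \<Rightarrow> real) \<Rightarrow> bool" where
  "regular_abel_function_real g I a \<longleftrightarrow>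
     (\<exists>D \<alpha>. regular_abel_function g D \<alpha> \<and> complex_of_real ` I \<subseteq> D \<and>
       (\<forall>x\<in>I. \<alpha> (complex_of_real x) = complex_of_real (a x)))"

end

theory Submission
  imports Defs "HOL-Real_Asymp.Real_Asymp"
begin

text \<open>
  In the coordinate \<open>2 / z\<close> both \<open>- h (- z)\<close> and the inverse of \<open>h\<close> become \<open>u \<mapsto> u + 1 + b / u + O(u\<^sup>-\<^sup>2)\<close>
  on the right half-plane, with \<open>b = 1/3\<close> and \<open>b = - 1/3\<close>. The logarithmically corrected coordinate
  \<open>T z = 2 / z - b ln (2 / z)\<close> advances by \<open>1 + O(z\<^sup>2)\<close> in each step, so \<open>T (f\<^sup>n z) - n\<close> converges
  to an Abel function \<open>A\<close>, which in the coordinate \<open>2 / z\<close> is close to the identity near \<open>\<infinity>\<close> and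
  therefore injective. If a truncation \<open>\<phi>\<close> of the formal iterate commutes with \<open>f\<close> up to high order,
  then \<open>A (\<phi> z) - A z\<close> is almost \<open>f\<close>-invariant, and following the orbit of \<open>z\<close> shows that it is
  close to \<open>\<tau>\<close>; this is the asymptotic expansion of \<open>A\<^sup>-\<^sup>1 (\<tau> + A z)\<close>. Conversely, the second-order
  expansion of \<open>\<sigma> (t + \<beta> z)\<close> for any regular Abel function \<open>\<beta>\<close> determines the increments of \<open>A\<close> along
  orbits, so that \<open>\<beta>\<close> and \<open>A\<close> have the same increments up to sign.
\<close>

text \<open>Two domains are in play. Orbits are followed in \<open>half_strip\<close>, which both
  maps preserve and on which both are injective. There \<open>z\<close> may tend to 0 nearly
  tangentially to the imaginary axis while \<open>Re (2 / z)\<close> stays bounded, and estimates in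
  powers of \<open>1 / Re (2 / z)\<close> then say nothing about powers of \<open>z\<close>. An
  asymptotic expansion concerns every approach to 0 inside the domain, so the Abel function is
  restricted to \<open>sector\<close>, where \<open>Re (2 / z)\<close> is at least
  \<open>1 / norm z\<close>.

  The degree of the truncation comes from a count: a polynomial of degree \<open>N + 4\<close>
  commutes with \<open>f\<close> up to \<open>O(z^(N+5))\<close>, the passage to
  \<open>2 / z\<close> loses two orders, two more pay for the convergence of the sum over the orbit,
  and \<open>z^(N+1)\<close> remains.

  That every orbit reaches the region near 0 where these estimates hold is a global matter that
  power series cannot settle; it rests on the strict inequality \<open>norm (f z) < norm z\<close>,
  valid up to the imaginary axis.\<close>

unbundle no vec_syntax

subsection \<open>Formal iterates\<close>

lemma fps_power_nth_cong:
  fixes K K' :: "'a::comm_ring_1 fps"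
  assumes "\<And>i. i \<le> n \<Longrightarrow> K $ i = K' $ i" and "m \<le> n"
  shows "(K ^ j) $ m = (K' ^ j) $ m"
  using assms(2)
proof (induction j arbitrary: m)
  case (Suc j)
  have "(K * K ^ j) $ m = (K' * K' ^ j) $ m"
    unfolding fps_mult_nth using Suc assms(1) by (intro sum.cong) auto
  then show ?case by simp
qed simp

lemma fps_compose_nth_cong:
  fixes F F' K K' :: "'a::comm_ring_1 fps"
  assumes "\<And>i. i \<le> n \<Longrightarrow> F $ i = F' $ i" "\<And>i. i \<le> n \<Longrightarrow> K $ i = K' $ i"
  shows "(F oo K) $ n = (F' oo K') $ n"
  unfolding fps_compose_nth
  using assms(1) fps_power_nth_cong[OF assms(2)] by (intro sum.cong) auto

lemma fps_power_nth_1: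
  fixes S :: "'a::comm_ring_1 fps"
  assumes "S $ 0 = 1"
  shows "(S ^ n) $ 1 = of_nat n * S $ 1"
proof (induction n)
  case (Suc n)
  have "(S ^ n) $ 0 = 1"
    using assms by (simp add: fps_nth_power_0)
  then show ?case
    using Suc assms by (simp add: fps_mult_nth_1 algebra_simps)
qed simp

text \<open>Adding \<open>c X^n\<close> changes \<open>P oo H\<close> by
  \<open>c H^n = c X^n (1 + n H_2 X + ...)\<close> and, to this order, \<open>H oo P\<close> by
  \<open>c X^n H'(P) = c X^n (1 + 2 H_2 X + ...)\<close>. The terms at \<open>X^n\<close> cancel, so
  the commutator first changes at order \<open>n + 1\<close>, by a multiple of \<open>n - 2\<close>:
  the second coefficient is free, and the later ones can be solved for when \<open>H_2\<close> is
  nonzero in characteristic 0.\<close>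

lemma fps_commutator_add_monom:
  fixes H P :: "'a::idom fps" and c :: 'a
  assumes H: "H $ 0 = 0" "H $ 1 = 1" and P: "P $ 0 = 0" "P $ 1 = 1"
    and n: "n \<ge> 2" and k: "k \<le> n + 1"
  defines "P' \<equiv> P + fps_const c * fps_X ^ n"
  shows "((P' oo H) - (H oo P')) $ k =
         ((P oo H) - (H oo P)) $ k + (if k = n + 1 then c * H $ 2 * (of_nat n - 2) else 0)"
proof -
  have P': "P' $ 0 = 0" "P' $ 1 = 1"
    using n P by (auto simp: P'_def)
  have HX: "H = fps_X * fps_shift 1 H"
    using H by (intro fps_ext) (auto simp: gr0_conv_Suc)
  have Hn: "H ^ n = fps_X ^ n * (fps_shift 1 H) ^ n"
    by (subst HX) (simp add: power_mult_distrib)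
  have "(fps_shift 1 H ^ n) $ 0 = 1" "(fps_shift 1 H ^ n) $ 1 = of_nat n * H $ 2"
    using H fps_power_nth_1[of "fps_shift 1 H" n] by (auto simp: fps_nth_power_0 numeral_2_eq_2)
  then have Hnk: "(H ^ n) $ k = (if k = n then 1 else if k = n + 1 then of_nat n * H $ 2 else 0)"
    unfolding Hn fps_X_power_mult_nth using k by auto
  have "P' oo H = (P oo H) + fps_const c * H ^ n"
    using H by (simp add: P'_def fps_compose_add_distrib fps_compose_mult_distrib
        flip: fps_compose_power)
  then have L: "(P' oo H) $ k = (P oo H) $ k + c * (H ^ n) $ k"
    by simp
  have pw0: "(Q ^ j) $ 0 = (if j = 0 then 1 else 0)" if "Q $ 0 = 0" for Q :: "'a fps" and j
    using that by (simp add: fps_nth_power_0)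
  have pw1: "(Q ^ j) $ 1 = (if j = 1 then 1 else 0)" if "Q $ 0 = 0" "Q $ 1 = 1" for Q :: "'a fps" and j
    using that by (cases j) (auto simp: fps_mult_nth_1 pw0[OF that(1), simplified])
  \<comment> \<open>The cofactor in the factorisation of \<open>P' ^ i - P ^ i\<close>; as
    \<open>k\<close> is at most \<open>n + 1\<close>, only its coefficients 0 and 1 are
    needed.\<close>
  define S where "S i = (\<Sum>j<i. P ^ (i - Suc j) * P' ^ j)" for i
  have diff: "P' ^ i = P ^ i + fps_const c * fps_X ^ n * S i" for i
    using power_diff_sumr2[of P' i P] by (simp add: S_def algebra_simps P'_def)
  have S0: "S i $ 0 = (if i = 1 then 1 else 0)" for i
  proof -
    have "S i $ 0 = (\<Sum>j<i. if j = 0 then (if i = 1 then 1 else 0) else 0)"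
      unfolding S_def fps_sum_nth
      by (intro sum.cong) (auto simp: pw0[OF P'(1), simplified] pw0[OF P(1), simplified])
    then show ?thesis
      by (auto simp: sum.delta)
  qed
  have S1: "S i $ 1 = (if i = 2 then 2 else 0)" for i
  proof -
    have "S i $ 1 = (\<Sum>j<i. (if j = 0 \<and> i = 2 then 1 else 0) + (if j = 1 \<and> i = 2 then 1 else 0))"
      unfolding S_def fps_sum_nth
      by (intro sum.cong)
        (auto simp: fps_mult_nth_1 pw1[OF P', simplified] pw1[OF P, simplified]
           pw0[OF P'(1), simplified] pw0[OF P(1), simplified])
    then show ?thesis
      by (auto simp: numeral_2_eq_2)
  qed
  have "(H oo P') $ k = (H oo P) $ k + c * (\<Sum>i=0..k. H $ i * (if k < n then 0 else S i $ (k - n)))"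
    unfolding fps_compose_nth diff fps_add_nth mult.assoc fps_mult_left_const_nth fps_X_power_mult_nth
    by (simp add: sum_distrib_left sum.distrib algebra_simps)
  also have "(\<Sum>i=0..k. H $ i * (if k < n then 0 else S i $ (k - n))) =
      (if k = n then 1 else if k = n + 1 then 2 * H $ 2 else 0)"
  proof -
    consider "k < n" | "k = n" | "k = n + 1" using k by linarith
    then show ?thesis
    proof cases
      case 2
      have "(\<Sum>i=0..n. H $ i * (if i = 1 then 1 else 0)) = H $ 1"
        using n by (subst sum.mono_neutral_right[of _ "{1}"]) auto
      then show ?thesis using 2 H S0 by simp
    next
      case 3
      have "(\<Sum>i=0..k. H $ i * (if i = 2 then 2 else 0)) = H $ 2 * 2"
        using n 3 by (subst sum.mono_neutral_right[of _ "{2}"]) auto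
      then show ?thesis using 3 S1 by (simp add: mult.commute)
    qed auto
  qed
  finally show ?thesis
    using L Hnk by (auto simp: algebra_simps)
qed

lemma formal_iterate_exists:
  fixes H :: "'a::field_char_0 fps"
  assumes H: "H $ 0 = 0" "H $ 1 = 1" "H $ 2 \<noteq> 0"
  obtains F where "F $ 0 = 0" "F $ 1 = 1" "F $ 2 = t * H $ 2" "F oo H = H oo F"
proof -
  define good where "good n P \<longleftrightarrow> P $ 0 = 0 \<and> P $ 1 = 1 \<and> P $ 2 = t * H $ 2 \<and>
      (\<forall>k\<le>n + 3. ((P oo H) - (H oo P)) $ k = 0)" for n and P :: "'a fps"
  have "\<exists>f. \<forall>n. good n (f n) \<and> (\<exists>c. f (Suc n) = f n + fps_const c * fps_X ^ (n + 3))"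
  proof (rule dependent_nat_choice)
    have "(fps_X + fps_const (t * H $ 2) * fps_X ^ 2) $ 2 = t * H $ 2"
      by (simp add: fps_X_power_nth)
    \<comment> \<open>With \<open>n = 2\<close> the factor \<open>n - 2\<close> vanishes, so the
      recursion can start with any \<open>t\<close>.\<close>
    moreover have "(((fps_X + fps_const (t * H $ 2) * fps_X ^ 2) oo H) -
          (H oo (fps_X + fps_const (t * H $ 2) * fps_X ^ 2))) $ k = 0" if "k \<le> 3" for k
      using that H by (subst fps_commutator_add_monom) (auto simp: fps_X_fps_compose_startby0)
    ultimately have "good 0 (fps_X + fps_const (t * H $ 2) * fps_X ^ 2)"
      by (auto simp: good_def)
    then show "\<exists>P. good 0 P" ..
  next
    fix P n assume P: "good n P"
    \<comment> \<open>Solves the equation at order \<open>n + 4\<close> for the coefficient at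
      \<open>n + 3\<close>; the factor \<open>n + 1\<close> is \<open>(n + 3) - 2\<close>.\<close>
    define c where "c = - ((P oo H) - (H oo P)) $ (n + 4) / (H $ 2 * of_nat (n + 1))"
    have nz: "H $ 2 * of_nat (n + 1) \<noteq> 0"
      using H by (metis add_eq_0_iff_both_eq_0 mult_eq_0_iff of_nat_eq_0_iff one_neq_zero)
    have c: "c * H $ 2 * (of_nat (n + 3) - 2) = - ((P oo H) - (H oo P)) $ (n + 4)"
    proof -
      have "c * H $ 2 * (of_nat (n + 3) - 2) = c * (H $ 2 * of_nat (n + 1))"
        by simp
      then show ?thesis using nz by (simp add: c_def)
    qed
    have "good (Suc n) (P + fps_const c * fps_X ^ (n + 3))"
      unfolding good_def
    proof (intro conjI allI impI)
      fix k assume "k \<le> Suc n + 3"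
      then have "(((P + fps_const c * fps_X ^ (n + 3)) oo H) - (H oo (P + fps_const c * fps_X ^ (n + 3)))) $ k
          = ((P oo H) - (H oo P)) $ k + (if k = n + 3 + 1 then c * H $ 2 * (of_nat (n + 3) - 2) else 0)"
        using P H by (intro fps_commutator_add_monom) (auto simp: good_def)
      then show "(((P + fps_const c * fps_X ^ (n + 3)) oo H) - (H oo (P + fps_const c * fps_X ^ (n + 3)))) $ k = 0"
        using P c \<open>k \<le> Suc n + 3\<close> by (cases "k = n + 4") (auto simp: good_def)
    qed (use P in \<open>auto simp: good_def\<close>)
    then show "\<exists>Q. good (Suc n) Q \<and> (\<exists>c. Q = P + fps_const c * fps_X ^ (n + 3))"
      by blast
  qed
  then obtain f where good: "\<And>n. good n (f n)"
    and step: "\<And>n. \<exists>c. f (Suc n) = f n + fps_const c * fps_X ^ (n + 3)"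
    by blast
  have stable: "f (k + m) $ k = f k $ k" for k m
  proof (induction m)
    case (Suc m)
    obtain c where "f (Suc (k + m)) = f (k + m) + fps_const c * fps_X ^ (k + m + 3)"
      using step by blast
    then show ?case using Suc by simp
  qed simp
  \<comment> \<open>Passing from \<open>f n\<close> to \<open>f (Suc n)\<close> touches only the
    coefficient at \<open>n + 3\<close>, so the diagonal picks final values.\<close>
  define F where "F = Abs_fps (\<lambda>k. f k $ k)"
  have F: "F $ i = f n $ i" if "i \<le> n" for i n
    using stable[of i "n - i"] that by (simp add: F_def)
  show ?thesis
  proof
    show "F $ 0 = 0" "F $ 1 = 1" "F $ 2 = t * H $ 2"
      using good[of 2] F[of _ 2] by (auto simp: good_def)
    show "F oo H = H oo F"
    proof (rule fps_ext)
      fix k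
      have "(F oo H) $ k = (f k oo H) $ k" "(H oo F) $ k = (H oo f k) $ k"
        using F by (auto intro!: fps_compose_nth_cong)
      moreover have "((f k oo H) - (H oo f k)) $ k = 0"
        using good[of k] unfolding good_def by (metis le_add1)
      ultimately show "(F oo H) $ k = (H oo F) $ k" by simp
    qed
  qed
qed

subsection \<open>Germs tangent to the identity\<close>

text \<open>Dividing by \<open>z ^ n\<close> leaves a function that is continuous at 0, hence
  bounded near it. The zero series is split off because its subdegree is 0 by convention.\<close>

lemma has_fps_expansion_bound:
  fixes f :: "complex \<Rightarrow> complex"
  assumes f: "f has_fps_expansion F" and F: "\<And>k. k < n \<Longrightarrow> F $ k = 0"
  obtains C r where "C > 0" "r > 0" "\<And>z. norm z < r \<Longrightarrow> norm (f z) \<le> C * norm z ^ n"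
proof (cases "F = 0")
  case True
  then have "eventually (\<lambda>z. f z = 0) (nhds 0)"
    using f by (simp add: has_fps_expansion_0_iff)
  then obtain r where "r > 0" "\<And>z. norm z < r \<Longrightarrow> f z = 0"
    by (auto simp: eventually_nhds_metric)
  then show ?thesis using that[of 1 r] by simp
next
  case False
  then have n: "n \<le> subdegree F"
    using F by (intro subdegree_geI) auto
  define k where "k x = (if x = 0 then F $ n else f x / x ^ n)" for x
  have "k has_fps_expansion fps_shift n F"
    unfolding k_def by (rule has_fps_expansion_shift[OF f n refl])
  then have "isCont k 0"
    using has_fps_expansion_imp_continuous by blast
  then have "eventually (\<lambda>x. norm (k x - k 0) < 1) (nhds 0)"
    unfolding continuous_at_eps_delta eventually_nhds_metric dist_norm
    by (metis zero_less_one)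
  then obtain r where r: "r > 0" "\<And>z. norm z < r \<Longrightarrow> norm (k z - k 0) < 1"
    by (auto simp: eventually_nhds_metric)
  have f0: "f 0 = F $ 0"
    using f has_fps_expansion_imp_0_eq_fps_nth_0 by metis
  have fk: "f z = k z * z ^ n" for z
    using F[of 0] f0 by (cases "n = 0") (auto simp: k_def)
  have "norm (f z) \<le> (norm (k 0) + 1) * norm z ^ n" if "norm z < r" for z
  proof -
    have "norm (k z) \<le> norm (k 0) + 1"
      using r(2)[OF that] norm_triangle_sub[of "k z" "k 0"] by linarith
    then show ?thesis
      by (simp add: fk norm_mult norm_power mult_right_mono)
  qed
  moreover have "norm (k 0) + 1 > 0"
    by (smt (verit) norm_ge_zero)
  ultimately show ?thesis
    using that r(1) by blast
qed

lemma fps_nth_mult_2: "(f * g) $ 2 = f $ 0 * g $ 2 + f $ 1 * g $ 1 + f $ 2 * g $ 0"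
  by (simp add: fps_mult_nth numeral_2_eq_2 sum.atLeast0_atMost_Suc)

lemma fps_inverse_nth_le_2:
  fixes P :: "complex fps"
  assumes "P $ 0 = 1"
  shows "inverse P $ 0 = 1" "inverse P $ 1 = - P $ 1" "inverse P $ 2 = (P $ 1)\<^sup>2 - P $ 2"
proof -
  have *: "inverse P * P = 1"
    using assms by (intro inverse_mult_eq_1) auto
  show 0: "inverse P $ 0 = 1"
    using assms by simp
  show 1: "inverse P $ 1 = - P $ 1"
    using arg_cong[OF *, of "\<lambda>f. f $ 1"] 0 assms
    by (simp add: fps_mult_nth_1 add_eq_0_iff algebra_simps)
  show "inverse P $ 2 = (P $ 1)\<^sup>2 - P $ 2"
    using arg_cong[OF *, of "\<lambda>f. f $ 2"] 0 1 assms
    by (simp add: fps_nth_mult_2 power2_eq_square algebra_simps add_eq_0_iff2)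
qed

locale tangent_to_identity =
  fixes f :: "complex \<Rightarrow> complex" and F :: "complex fps"
  assumes fps: "f has_fps_expansion F" and F0: "F $ 0 = 0" and F1: "F $ 1 = 1"
begin

definition quot :: "complex \<Rightarrow> complex" where
  "quot z = (if z = 0 then 1 else f z / z)"

lemma quot_fps: "quot has_fps_expansion fps_shift 1 F"
proof -
  have "1 \<le> subdegree F"
    using F0 F1 by (intro subdegree_geI) auto
  from has_fps_expansion_shift[OF fps this, of 1] show ?thesis
    using F1 by (simp only: quot_def[abs_def] power_one_right refl simp_thms)
qed

lemma inverse_quot_fps: "(\<lambda>z. inverse (quot z)) has_fps_expansion inverse (fps_shift 1 F)"
  using F1 by (intro has_fps_expansion_inverse quot_fps) auto

lemma quot_tendsto: "(quot \<longlongrightarrow> 1) (nhds 0)"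
proof -
  have "isCont quot 0"
    using has_fps_expansion_imp_continuous[OF quot_fps] by blast
  moreover have "quot 0 = 1" by (simp add: quot_def)
  ultimately show ?thesis
    by (metis continuous_at_imp_continuous_at_within isCont_def tendsto_at_iff_tendsto_nhds)
qed

lemma quot_near_1:
  assumes "e > 0"
  obtains r where "r > 0" "\<And>z. norm z < r \<Longrightarrow> norm (quot z - 1) < e"
  using tendstoD[OF quot_tendsto assms] by (auto simp: eventually_nhds_metric dist_norm)

lemma norm_ge_half:
  obtains r where "r > 0" "\<And>z. norm z < r \<Longrightarrow> norm z / 2 \<le> norm (f z)"
proof -
  obtain r where r: "r > 0" "\<And>z. norm z < r \<Longrightarrow> norm (quot z - 1) < 1/2"
    using quot_near_1[of "1/2"] by auto
  have "norm z / 2 \<le> norm (f z)" if "norm z < r" for z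
  proof (cases "z = 0")
    case False
    have "1/2 \<le> norm (quot z)"
      using r(2)[OF that] norm_triangle_ineq2[of 1 "1 - quot z"] by (simp add: norm_minus_commute)
    then have "1/2 * norm z \<le> norm (quot z) * norm z"
      by (intro mult_right_mono) auto
    then show ?thesis using False
      by (simp add: quot_def norm_divide)
  qed auto
  then show ?thesis using that r by blast
qed

text \<open>The series of \<open>1 / quot\<close> starts with \<open>1 - F_2 z\<close>, so in the
  coordinate \<open>2 / z\<close> the map is translation by \<open>- 2 F_2\<close> up to
  \<open>O(z)\<close>. This serves both \<open>f\<close>, a translation by 1, and truncated
  iterates, translations by \<open>\<tau>\<close>.\<close>

lemma reciprocal_expansion:
  obtains C r where "C > 0" "r > 0"
    "\<And>z. norm z < r \<Longrightarrow> z \<noteq> 0 \<Longrightarrow> f z \<noteq> 0 \<and> norm (2 / f z - 2 / z + 2 * F $ 2) \<le> C * norm z"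
proof -
  define k where "k z = inverse (quot z) - 1 + F $ 2 * z" for z
  define K where "K = inverse (fps_shift 1 F) - 1 + fps_const (F $ 2) * fps_X"
  have "k has_fps_expansion K"
    unfolding k_def[abs_def] K_def by (intro fps_expansion_intros inverse_quot_fps)
  moreover have "K $ 0 = 0" "K $ 1 = 0"
    using fps_inverse_nth_le_2(2)[of "fps_shift 1 F"] F1 by (auto simp: K_def numeral_2_eq_2)
  then have "K $ i = 0" if "i < 2" for i
    using that by (auto simp: less_2_cases_iff)
  ultimately obtain C r where C: "C > 0" "r > 0" "\<And>z. norm z < r \<Longrightarrow> norm (k z) \<le> C * norm z ^ 2"
    using has_fps_expansion_bound[of k K 2] by blast
  obtain r' where r': "r' > 0" "\<And>z. norm z < r' \<Longrightarrow> norm z / 2 \<le> norm (f z)"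
    using norm_ge_half by blast
  show ?thesis
  proof (rule that[of "2 * C" "min r r'"])
    fix z :: complex assume z: "norm z < min r r'" "z \<noteq> 0"
    then have "f z \<noteq> 0" using r'(2)[of z] by auto
    moreover have "2 / f z - 2 / z + 2 * F $ 2 = 2 * k z / z"
      using z \<open>f z \<noteq> 0\<close> by (simp add: k_def quot_def field_simps)
    moreover have "norm (2 * k z / z) \<le> 2 * C * norm z"
      using C(3)[of z] z by (simp add: norm_mult norm_divide field_simps power2_eq_square)
    ultimately show "f z \<noteq> 0 \<and> norm (2 / f z - 2 / z + 2 * F $ 2) \<le> 2 * C * norm z"
      by simp
  qed (use C r' in auto)
qed

text \<open>The logarithm cancels the term of \<open>2 / f z - 2 / z - 1\<close> that is linear in \<open>z\<close>, which would
  not be summable along an orbit.\<close>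

lemma log_corrected_expansion:
  assumes F2: "F $ 2 = - 1 / 2"
  defines "b \<equiv> 1 - 4 * F $ 3"
  obtains C r where "C > 0" "r > 0"
    "\<And>z. norm z < r \<Longrightarrow> 0 < Re z \<Longrightarrow> 0 < Re (f z) \<Longrightarrow>
      norm (2 / f z - b * Ln (2 / f z) - (2 / z - b * Ln (2 / z)) - 1) \<le> C * norm z ^ 2"
proof -
  define P where "P = fps_shift 1 F"
  have P: "P $ 0 = 1" "P $ 1 = - 1 / 2" "P $ 2 = F $ 3"
    using F1 F2 by (simp_all add: P_def numeral_2_eq_2 numeral_3_eq_3)
  define lq where "lq z = Ln (quot z)" for z
  have "quot analytic_on {0}"
    using quot_fps has_fps_expansion_imp_analytic_0 by blast
  moreover have "quot 0 = 1" by (simp add: quot_def)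
  ultimately have "lq analytic_on {0}"
    unfolding lq_def[abs_def] by (intro analytic_intros) auto
  then obtain L where L: "lq has_fps_expansion L"
    using analytic_at_imp_has_fps_expansion_0 by blast
  have L0: "L $ 0 = 0"
    using has_fps_expansion_imp_0_eq_fps_nth_0[OF L] \<open>quot 0 = 1\<close> by (simp add: lq_def)
  have "((\<lambda>x. exp x) \<circ> lq) has_fps_expansion (fps_exp 1 oo L)"
    using L L0 by (intro has_fps_expansion_compose has_fps_expansion_exp1) auto
  moreover have "eventually (\<lambda>z. ((\<lambda>x. exp x) \<circ> lq) z = quot z) (nhds 0)"
  proof -
    have "eventually (\<lambda>z. quot z \<noteq> 0) (nhds 0)"
      using quot_tendsto by (rule tendsto_imp_eventually_ne) auto
    then show ?thesis
      by eventually_elim (simp add: lq_def)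
  qed
  ultimately have "quot has_fps_expansion (fps_exp 1 oo L)"
    using has_fps_expansion_cong by blast
  then have expL: "fps_exp 1 oo L = P"
    using quot_fps fps_expansion_unique_complex P_def by blast
  have L1: "L $ 1 = - 1 / 2"
    using arg_cong[OF expL, of "\<lambda>f. f $ 1"] P by (simp add: fps_compose_nth)
  \<comment> \<open>The error of the claim multiplied by \<open>z\<close>. Its coefficient at
    \<open>z^2\<close> is \<open>2 (1/4 - F_3) - b / 2\<close>; making it vanish is the origin of
    \<open>b\<close>.\<close>
  define k where "k z = 2 * (inverse (quot z) - 1) - z + b * (z * lq z)" for z
  define K where "K = 2 * (inverse P - 1) - fps_X + fps_const b * (fps_X * L)"
  have "k has_fps_expansion K"
    unfolding k_def[abs_def] K_def P_def by (intro fps_expansion_intros inverse_quot_fps L)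
  moreover have "K $ i = 0" if "i < 3" for i
  proof -
    have "K $ 0 = 0" "K $ 1 = 0"
      using fps_inverse_nth_le_2[of P] P L0 by (auto simp: K_def numeral_fps_const mult.commute)
    moreover have "inverse P $ 2 = 1 / 4 - F $ 3"
      using fps_inverse_nth_le_2(3)[of P] P by (simp add: power2_eq_square)
    then have "K $ 2 = 0"
      using L1 by (simp add: K_def b_def numeral_fps_const)
    ultimately show ?thesis
      using that by (auto simp: less_Suc_eq numeral_3_eq_3 numeral_2_eq_2)
  qed
  ultimately obtain C r where C: "C > 0" "r > 0" "\<And>z. norm z < r \<Longrightarrow> norm (k z) \<le> C * norm z ^ 3"
    using has_fps_expansion_bound[of k K 3] by blast
  obtain r' where r': "r' > 0" "\<And>z. norm z < r' \<Longrightarrow> norm (quot z - 1) < 1"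
    using quot_near_1[of 1] by auto
  show ?thesis
  proof (rule that[of C "min r r'"])
    fix z :: complex assume z: "norm z < min r r'" "0 < Re z" "0 < Re (f z)"
    then have nz: "z \<noteq> 0" "f z \<noteq> 0" by auto
    \<comment> \<open>Both \<open>2 / f z\<close> and \<open>quot z\<close> have arguments below
      \<open>pi / 2\<close> in absolute value, so the principal logarithm is additive on their
      product \<open>2 / z\<close>.\<close>
    have "\<bar>Re (quot z - 1)\<bar> < 1"
      using r'(2)[of z] z(1) abs_Re_le_cmod[of "quot z - 1"] by linarith
    then have "0 < Re (quot z)" by simp
    then have "\<bar>Im (Ln (quot z))\<bar> < pi / 2"
      by (rule Re_Ln_pos_lt_imp)
    moreover have "0 < Re (2 / f z)"
      using z(3) nz by (simp add: Re_divide zero_less_divide_iff sum_power2_gt_zero_iff complex_eq_iff)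
    then have "\<bar>Im (Ln (2 / f z))\<bar> < pi / 2"
      by (rule Re_Ln_pos_lt_imp)
    ultimately have "Ln (2 / f z * quot z) = Ln (2 / f z) + Ln (quot z)"
      using nz \<open>0 < Re (quot z)\<close> by (intro Ln_times_simple) auto
    moreover have "2 / f z * quot z = 2 / z"
      using nz by (simp add: quot_def)
    ultimately have "2 / f z - b * Ln (2 / f z) - (2 / z - b * Ln (2 / z)) - 1 = k z / z"
      using nz by (simp add: k_def lq_def quot_def field_simps)
    then show "norm (2 / f z - b * Ln (2 / f z) - (2 / z - b * Ln (2 / z)) - 1) \<le> C * norm z ^ 2"
      using C(3)[of z] z nz
      by (simp add: norm_divide divide_le_eq power2_eq_square power3_eq_cube mult.assoc)
  qed (use C r' in auto)
qed

end

text \<open>Each term \<open>1 / y^2\<close> is at most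
  \<open>1 / (y (y - 1/2)) = 2 / (y - 1/2) - 2 / y\<close>, which telescopes in steps of
  \<open>1 / 2\<close>. That step is the growth of \<open>Re (2 / z)\<close> guaranteed per
  iteration.\<close>

lemma sum_inverse_squares_bound:
  fixes x :: real
  assumes "x \<ge> 1"
  shows "summable (\<lambda>n. 1 / (x + real n / 2)\<^sup>2)" "(\<Sum>n. 1 / (x + real n / 2)\<^sup>2) \<le> 4 / x"
proof -
  define t where "t n = 2 / (x + real n / 2 - 1/2)" for n
  have "t \<longlonglongrightarrow> 0"
    unfolding t_def by real_asymp
  from telescope_sums'[OF this] have t: "(\<lambda>n. t n - t (Suc n)) sums t 0"
    by simp
  have le: "1 / (x + real n / 2)\<^sup>2 \<le> t n - t (Suc n)" for n
  proof -
    define y where "y = x + real n / 2"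
    have y: "y \<ge> 1" using assms by (simp add: y_def)
    have "t n - t (Suc n) = 2 / (y - 1/2) - 2 / y"
      by (simp add: t_def y_def add_divide_distrib)
    also have "\<dots> = 1 / (y * (y - 1/2))"
      using y by (simp add: field_simps)
    also have "\<dots> \<ge> 1 / y\<^sup>2"
      unfolding power2_eq_square using y by (intro divide_left_mono mult_left_mono mult_pos_pos) auto
    finally show ?thesis by (simp add: y_def)
  qed
  show s: "summable (\<lambda>n. 1 / (x + real n / 2)\<^sup>2)"
    by (rule summable_comparison_test'[OF sums_summable[OF t], where N=0]) (use le in simp)
  have "(\<Sum>n. 1 / (x + real n / 2)\<^sup>2) \<le> t 0"
    using suminf_le[OF le s sums_summable[OF t]] sums_unique[OF t] by simp
  also have "t 0 \<le> 4 / x"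
    using assms by (simp add: t_def field_simps)
  finally show "(\<Sum>n. 1 / (x + real n / 2)\<^sup>2) \<le> 4 / x" .
qed

subsection \<open>The Abel function of a parabolic germ\<close>

lemma Re_reciprocal_pos: "0 < Re (2 / z) \<longleftrightarrow> 0 < Re (z :: complex)"
  by (cases "z = 0")
    (auto simp: Re_divide zero_less_divide_iff sum_power2_gt_zero_iff complex_eq_iff not_sum_power2_lt_zero)

lemma norm_le_Re_reciprocal:
  assumes "0 < x" "x \<le> Re (2 / z)"
  shows "norm (z :: complex) \<le> 2 / x"
proof -
  have "x \<le> norm (2 / z)"
    using assms complex_Re_le_cmod[of "2 / z"] by linarith
  then show ?thesis
    using assms by (cases "z = 0") (auto simp: norm_divide field_simps)
qed

text \<open>The width \<open>2 pi\<close> is the period of \<open>exp\<close>, which makes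
  \<open>1 - exp (- z)\<close> injective here.\<close>

definition half_strip :: "complex set" where
  "half_strip = {z. 0 < Re z \<and> \<bar>Im z\<bar> < pi}"

lemma open_half_strip: "open half_strip"
proof -
  have "half_strip = {z. 0 < Re z} \<inter> {z. Im z < pi} \<inter> {z. - pi < Im z}"
    by (auto simp: half_strip_def)
  then show ?thesis
    using open_halfspace_Re_gt open_halfspace_Im_lt open_halfspace_Im_gt by (metis open_Int)
qed

lemma half_strip_nonzero: "z \<in> half_strip \<Longrightarrow> z \<noteq> 0"
  by (auto simp: half_strip_def)

lemma half_strip_near_0:
  assumes "2 \<le> x" "x \<le> Re (2 / z)"
  shows "z \<in> half_strip"
proof -
  have "norm z \<le> 2 / x"
    using assms by (intro norm_le_Re_reciprocal) auto
  also have "\<dots> \<le> 1" using assms by simp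
  finally have "\<bar>Im z\<bar> \<le> 1"
    using abs_Im_le_cmod[of z] by linarith
  moreover have "0 < Re z"
    using assms Re_reciprocal_pos[of z] by simp
  ultimately show ?thesis
    using pi_gt3 by (auto simp: half_strip_def)
qed

text \<open>Continuity and the strict decrease of the norm are asked for up to the imaginary axis
  because the compactness argument for orbits uses sets that touch it.\<close>

locale parabolic_germ = tangent_to_identity f F for f F +
  assumes F2: "F $ 2 = - 1 / 2"
    and cont: "continuous_on {z. 0 \<le> Re z} f"
    and holo: "f holomorphic_on half_strip"
    and maps: "z \<in> half_strip \<Longrightarrow> f z \<in> half_strip"
    and inj: "inj_on f half_strip"
    and norm_less: "0 \<le> Re z \<Longrightarrow> z \<noteq> 0 \<Longrightarrow> norm (f z) < norm z"
begin

definition b :: complex where "b = 1 - 4 * F $ 3"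
definition T :: "complex \<Rightarrow> complex" where "T z = 2 / z - b * Ln (2 / z)"
definition \<eta> :: "complex \<Rightarrow> complex" where "\<eta> z = T (f z) - T z - 1"

text \<open>The two constants form a pair so that a single choice fixes both for the whole
  locale.\<close>

lemma local_constants:
  "\<exists>eC. 0 < fst eC \<and> fst eC \<le> 1 \<and> 0 < snd eC \<and> (\<forall>z\<in>half_strip. norm z < fst eC \<longrightarrow>
      Re (2 / f z) \<ge> Re (2 / z) + 1 / 2 \<and> norm (\<eta> z) \<le> snd eC * norm z ^ 2)"
proof -
  obtain C r where C: "C > 0" "r > 0"
    "\<And>z. norm z < r \<Longrightarrow> 0 < Re z \<Longrightarrow> 0 < Re (f z) \<Longrightarrow>
      norm (2 / f z - b * Ln (2 / f z) - (2 / z - b * Ln (2 / z)) - 1) \<le> C * norm z ^ 2"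
    using log_corrected_expansion[OF F2] unfolding b_def by blast
  obtain C' r' where C': "C' > 0" "r' > 0"
    "\<And>z. norm z < r' \<Longrightarrow> z \<noteq> 0 \<Longrightarrow> f z \<noteq> 0 \<and> norm (2 / f z - 2 / z + 2 * F $ 2) \<le> C' * norm z"
    using reciprocal_expansion by blast
  \<comment> \<open>The bound \<open>1 / (2 * C')\<close> makes each step in the coordinate
    \<open>2 / z\<close> differ from 1 by at most \<open>1 / 2\<close>.\<close>
  define e where "e = min (min 1 r) (min r' (1 / (2 * C')))"
  have "Re (2 / f z) \<ge> Re (2 / z) + 1 / 2 \<and> norm (\<eta> z) \<le> C * norm z ^ 2"
    if z: "z \<in> half_strip" "norm z < e" for z
  proof
    have "C' * norm z \<le> C' * (1 / (2 * C'))"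
      using z C' by (intro mult_left_mono) (auto simp: e_def)
    also have "\<dots> = 1 / 2" using C' by simp
    finally have "norm (2 / f z - 2 / z - 1) \<le> 1 / 2"
      using C'(3)[of z] z half_strip_nonzero[of z] F2 by (auto simp: e_def)
    then have "\<bar>Re (2 / f z - 2 / z - 1)\<bar> \<le> 1 / 2"
      using abs_Re_le_cmod order_trans by blast
    then show "Re (2 / f z) \<ge> Re (2 / z) + 1 / 2"
      unfolding minus_complex.sel one_complex.sel by linarith
    show "norm (\<eta> z) \<le> C * norm z ^ 2"
      using C(3)[of z] z maps[OF z(1)] by (simp add: \<eta>_def T_def e_def half_strip_def)
  qed
  then show ?thesis
    using C C' by (intro exI[of _ "(e, C)"]) (auto simp: e_def)
qed

definition \<epsilon> :: real where
  "\<epsilon> = fst (SOME eC. 0 < fst eC \<and> fst eC \<le> 1 \<and> 0 < snd eC \<and> (\<forall>z\<in>half_strip. norm z < fst eC \<longrightarrow>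
      Re (2 / f z) \<ge> Re (2 / z) + 1 / 2 \<and> norm (\<eta> z) \<le> snd eC * norm z ^ 2))"
definition C :: real where
  "C = snd (SOME eC. 0 < fst eC \<and> fst eC \<le> 1 \<and> 0 < snd eC \<and> (\<forall>z\<in>half_strip. norm z < fst eC \<longrightarrow>
      Re (2 / f z) \<ge> Re (2 / z) + 1 / 2 \<and> norm (\<eta> z) \<le> snd eC * norm z ^ 2))"

lemma \<epsilon>: "0 < \<epsilon>" "\<epsilon> \<le> 1" and C_pos: "0 < C"
  and Re_step: "z \<in> half_strip \<Longrightarrow> norm z < \<epsilon> \<Longrightarrow> Re (2 / f z) \<ge> Re (2 / z) + 1 / 2"
  and \<eta>_bound: "z \<in> half_strip \<Longrightarrow> norm z < \<epsilon> \<Longrightarrow> norm (\<eta> z) \<le> C * norm z ^ 2"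
  using someI_ex[OF local_constants] unfolding \<epsilon>_def C_def by blast+

definition X0 :: real where "X0 = 2 / \<epsilon>"
text \<open>The disc of radius \<open>1 / X0\<close> tangent to the imaginary axis at 0, which is a
  half-plane in the coordinate \<open>2 / z\<close>. Since \<open>2 / 0 = 0\<close>, the origin is
  left out.\<close>

definition W :: "complex set" where "W = {z. X0 < Re (2 / z)}"

lemma X0: "2 \<le> X0"
  using \<epsilon> by (simp add: X0_def field_simps)

lemma W_subset: "z \<in> W \<Longrightarrow> z \<in> half_strip"
  using X0 half_strip_near_0[of X0 z] by (simp add: W_def)

lemma W_norm: "z \<in> W \<Longrightarrow> norm z < \<epsilon>"
proof -
  assume z: "z \<in> W"
  have "norm z \<le> 2 / Re (2 / z)"
    using z X0 by (intro norm_le_Re_reciprocal) (auto simp: W_def)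
  also have "\<dots> < 2 / X0"
    using z X0 by (intro divide_strict_left_mono mult_pos_pos) (auto simp: W_def)
  finally show ?thesis by (simp add: X0_def)
qed

lemma open_W: "open W"
proof -
  have "open ((- {0}) \<inter> (\<lambda>z. Re (2 / z)) -` {X0<..})"
    by (intro continuous_open_preimage continuous_intros) auto
  moreover have "(- {0}) \<inter> (\<lambda>z. Re (2 / z)) -` {X0<..} = W"
    using X0 by (auto simp: W_def)
  ultimately show ?thesis by simp
qed

section \<open>Orbits in the half-strip\<close>

lemma half_strip_iter: "z \<in> half_strip \<Longrightarrow> (f ^^ n) z \<in> half_strip"
  by (induction n) (auto intro: maps)

lemma iter_inj: "inj_on (f ^^ n) half_strip"
proof (induction n)
  case (Suc n)
  have "inj_on f ((f ^^ n) ` half_strip)"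
    using inj half_strip_iter by (auto intro: inj_on_subset)
  then show ?case
    using comp_inj_on[OF Suc] by (simp add: o_def)
qed simp

lemma iter_holo: "(f ^^ n) holomorphic_on half_strip"
proof (induction n)
  case (Suc n)
  have "f holomorphic_on (f ^^ n) ` half_strip"
    using holo half_strip_iter by (auto intro: holomorphic_on_subset)
  from holomorphic_on_compose[OF Suc this] show ?case
    by (simp add: o_def)
qed (simp add: id_def)

lemma iter_W: "z \<in> W \<Longrightarrow> (f ^^ n) z \<in> W \<and> Re (2 / z) + real n / 2 \<le> Re (2 / (f ^^ n) z)"
proof (induction n)
  case (Suc n)
  then have "(f ^^ n) z \<in> W" by blast
  then have "Re (2 / (f ^^ n) z) + 1 / 2 \<le> Re (2 / f ((f ^^ n) z))"
    using Re_step W_subset W_norm by blast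
  then show ?case using Suc by (auto simp: W_def field_simps)
qed simp

text \<open>An orbit that stays away from 0 would remain in a compact part of the closed right
  half-plane, where \<open>norm (f w) / norm w\<close> attains a maximum \<open>q < 1\<close>; its
  norms would then decay geometrically.\<close>

lemma iter_tendsto_0:
  assumes z: "z \<in> half_strip" and "e > 0"
  obtains n where "norm ((f ^^ n) z) < e"
proof (rule ccontr)
  assume "\<not> thesis"
  then have ge: "e \<le> norm ((f ^^ n) z)" for n
    using that[of n] by (cases "norm ((f ^^ n) z) < e") auto
  define K where "K = {w. 0 \<le> Re w} \<inter> (cball 0 (norm z) - ball 0 e)"
  have "closed {w. 0 \<le> Re w}"
    by (simp add: closed_halfspace_Re_ge)
  then have "compact K"
    unfolding K_def by (intro closed_Int_compact compact_diff) auto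
  have iter: "(f ^^ n) z \<in> half_strip" for n
    using z by (rule half_strip_iter)
  have dec: "norm ((f ^^ n) z) \<le> norm z" for n
  proof (induction n)
    case (Suc n)
    then show ?case
      using norm_less[of "(f ^^ n) z"] iter[of n] half_strip_nonzero[OF iter[of n]]
      by (auto simp: half_strip_def)
  qed simp
  have inK: "(f ^^ n) z \<in> K" for n
    using iter[of n] dec ge[of n] by (auto simp: K_def half_strip_def)
  have "continuous_on K (\<lambda>w. norm (f w) / norm w)"
  proof (intro continuous_on_divide continuous_on_norm continuous_on_id)
    show "continuous_on K f"
      using cont by (rule continuous_on_subset) (auto simp: K_def)
  qed (use \<open>e > 0\<close> in \<open>auto simp: K_def\<close>)
  moreover have "K \<noteq> {}" using inK by blast
  ultimately have "\<exists>w\<in>K. \<forall>y\<in>K. norm (f y) / norm y \<le> norm (f w) / norm w"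
    using \<open>compact K\<close> by (intro continuous_attains_sup)
  then obtain w where w: "w \<in> K" "\<And>y. y \<in> K \<Longrightarrow> norm (f y) / norm y \<le> norm (f w) / norm w"
    by blast
  define q where "q = norm (f w) / norm w"
  have "w \<noteq> 0" "0 \<le> Re w" using w(1) \<open>e > 0\<close> by (auto simp: K_def)
  then have q: "0 \<le> q" "q < 1"
    using norm_less[of w] by (auto simp: q_def)
  have pow: "norm ((f ^^ n) z) \<le> q ^ n * norm z" for n
  proof (induction n)
    case (Suc n)
    have "norm (f ((f ^^ n) z)) \<le> q * norm ((f ^^ n) z)"
      using w(2)[OF inK[of n]] half_strip_nonzero[OF iter[of n]] by (simp add: q_def divide_le_eq)
    also have "\<dots> \<le> q * (q ^ n * norm z)"
      using Suc q by (intro mult_left_mono)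
    finally show ?case by simp
  qed simp
  obtain n where "q ^ n < e / norm z"
    using real_arch_pow_inv[of "e / norm z" q] q \<open>e > 0\<close> half_strip_nonzero[OF z] by auto
  then have "q ^ n * norm z < e"
    using half_strip_nonzero[OF z] by (simp add: field_simps)
  then show False using pow[of n] ge[of n] by linarith
qed

text \<open>A small norm alone does not put a point into the tangent disc \<open>W\<close>. But once
  the norm is below \<open>\<epsilon>\<close> it stays there, and \<open>Re (2 / z)\<close> gains at
  least \<open>1 / 2\<close> per step until it exceeds \<open>X0\<close>.\<close>

lemma iter_enters_W:
  assumes z: "z \<in> half_strip"
  obtains n where "(f ^^ n) z \<in> W"
proof -
  obtain m where m: "norm ((f ^^ m) z) < \<epsilon>"
    using iter_tendsto_0[OF z \<epsilon>(1)] .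
  define w where "w = (f ^^ m) z"
  have w: "w \<in> half_strip" using half_strip_iter[OF z] by (simp add: w_def)
  have small: "norm ((f ^^ n) w) < \<epsilon>" for n
  proof (induction n)
    case (Suc n)
    then show ?case
      using norm_less[of "(f ^^ n) w"] half_strip_iter[OF w, of n] half_strip_nonzero[of "(f ^^ n) w"]
      by (auto simp: half_strip_def)
  qed (use m w_def in simp)
  have grow: "real n / 2 \<le> Re (2 / (f ^^ n) w)" for n
  proof (induction n)
    case 0
    then show ?case using w Re_reciprocal_pos[of w] by (simp add: half_strip_def)
  next
    case (Suc n)
    then show ?case
      using Re_step[OF half_strip_iter[OF w, of n] small[of n]] by (simp add: field_simps)
  qed
  obtain n where "X0 < real n / 2"
    using reals_Archimedean2[of "2 * X0"] by (auto simp: field_simps)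
  then have "(f ^^ (n + m)) z \<in> W"
    using grow[of n] by (simp add: W_def w_def funpow_add)
  then show ?thesis using that by blast
qed

section \<open>Construction and holomorphy of the Abel function\<close>

definition A :: "complex \<Rightarrow> complex" where
  "A z = lim (\<lambda>n. T ((f ^^ n) z) - of_nat n)"

lemma T_iter: "T ((f ^^ n) z) - of_nat n = T z + (\<Sum>i<n. \<eta> ((f ^^ i) z))"
  by (induction n) (auto simp: \<eta>_def algebra_simps)

lemma \<eta>_iter_bound:
  assumes "z \<in> W" "0 < x" "x \<le> Re (2 / z)"
  shows "norm (\<eta> ((f ^^ n) z)) \<le> 4 * C * (1 / (x + real n / 2)\<^sup>2)"
proof -
  have zn: "(f ^^ n) z \<in> W" and "x + real n / 2 \<le> Re (2 / (f ^^ n) z)"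
    using iter_W[OF assms(1), of n] assms by auto
  then have "norm ((f ^^ n) z) \<le> 2 / (x + real n / 2)"
    using assms by (intro norm_le_Re_reciprocal) auto
  then have "norm ((f ^^ n) z) ^ 2 \<le> (2 / (x + real n / 2)) ^ 2"
    by (intro power_mono) auto
  then have "C * norm ((f ^^ n) z) ^ 2 \<le> C * (2 / (x + real n / 2)) ^ 2"
    using C_pos by (intro mult_left_mono) auto
  also have "\<dots> = 4 * C * (1 / (x + real n / 2)\<^sup>2)"
    by (simp add: power_divide)
  finally show ?thesis
    using \<eta>_bound[OF W_subset[OF zn] W_norm[OF zn]] by linarith
qed

text \<open>\<open>A\<close> is \<open>T\<close> plus the sum of the one-step errors. The decay of
  that sum in \<open>Re (2 / z)\<close> is what later makes \<open>A\<close> comparable with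
  \<open>2 / z\<close>.\<close>

lemma W_sums:
  assumes z: "z \<in> W"
  shows "summable (\<lambda>n. \<eta> ((f ^^ n) z))"
    "(\<lambda>n. T ((f ^^ n) z) - of_nat n) \<longlonglongrightarrow> A z"
    "A z = T z + (\<Sum>n. \<eta> ((f ^^ n) z))"
    "norm (\<Sum>n. \<eta> ((f ^^ n) z)) \<le> 16 * C / Re (2 / z)"
proof -
  define x where "x = Re (2 / z)"
  have x: "1 \<le> x" using X0 z by (simp add: W_def x_def)
  have bd: "norm (\<eta> ((f ^^ n) z)) \<le> 4 * C * (1 / (x + real n / 2)\<^sup>2)" for n
    using z x by (intro \<eta>_iter_bound) (auto simp: x_def)
  note sb = sum_inverse_squares_bound[OF x]
  have sm: "summable (\<lambda>n. 4 * C * (1 / (x + real n / 2)\<^sup>2))"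
    using sb by (intro summable_mult)
  show s: "summable (\<lambda>n. \<eta> ((f ^^ n) z))"
    by (rule summable_comparison_test'[OF sm, where N=0]) (use bd in auto)
  have "(\<lambda>n. T z + (\<Sum>i<n. \<eta> ((f ^^ i) z))) \<longlonglongrightarrow> T z + (\<Sum>n. \<eta> ((f ^^ n) z))"
    using summable_LIMSEQ[OF s] by (intro tendsto_intros)
  then have l: "(\<lambda>n. T ((f ^^ n) z) - of_nat n) \<longlonglongrightarrow> T z + (\<Sum>n. \<eta> ((f ^^ n) z))"
    by (simp add: T_iter)
  then show A: "A z = T z + (\<Sum>n. \<eta> ((f ^^ n) z))"
    unfolding A_def by (rule limI)
  show "(\<lambda>n. T ((f ^^ n) z) - of_nat n) \<longlonglongrightarrow> A z"
    using l A by simp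
  have "norm (\<Sum>n. \<eta> ((f ^^ n) z)) \<le> (\<Sum>n. 4 * C * (1 / (x + real n / 2)\<^sup>2))"
    using bd sm by (intro norm_suminf_le)
  also have "\<dots> = 4 * C * (\<Sum>n. 1 / (x + real n / 2)\<^sup>2)"
    using sb by (intro suminf_mult)
  also have "\<dots> \<le> 4 * C * (4 / x)"
    using sb C_pos by (intro mult_left_mono) auto
  finally show "norm (\<Sum>n. \<eta> ((f ^^ n) z)) \<le> 16 * C / Re (2 / z)"
    by (simp add: x_def)
qed

lemma T_holo: "T holomorphic_on half_strip"
proof -
  have "2 / z \<notin> \<real>\<^sub>\<le>\<^sub>0" if "z \<in> half_strip" for z
    using that Re_reciprocal_pos[of z] by (auto simp: half_strip_def complex_nonpos_Reals_iff)
  then show ?thesis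
    unfolding T_def[abs_def] using half_strip_nonzero
    by (intro holomorphic_intros) auto
qed

lemma \<eta>_holo: "\<eta> holomorphic_on half_strip"
proof -
  have "(T \<circ> f) holomorphic_on half_strip"
    using holo T_holo maps by (intro holomorphic_on_compose) (auto intro: holomorphic_on_subset)
  then show ?thesis
    unfolding \<eta>_def[abs_def] using T_holo by (auto intro!: holomorphic_intros simp: o_def)
qed

lemma correction_holo_W: "(\<lambda>z. \<Sum>n. \<eta> ((f ^^ n) z)) holomorphic_on W"
proof (rule holomorphic_uniform_sequence[OF open_W])
  show "(\<lambda>z. \<Sum>i<n. \<eta> ((f ^^ i) z)) holomorphic_on W" for n
  proof (intro holomorphic_on_sum)
    fix i
    have "(\<eta> \<circ> (f ^^ i)) holomorphic_on half_strip"
      using half_strip_iter \<eta>_holo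
      by (intro holomorphic_on_compose iter_holo) (auto intro: holomorphic_on_subset)
    then show "(\<lambda>z. \<eta> ((f ^^ i) z)) holomorphic_on W"
      using W_subset by (auto simp: o_def intro: holomorphic_on_subset)
  qed
  fix z assume "z \<in> W"
  then obtain d where d: "d > 0" "cball z d \<subseteq> W"
    using open_W open_contains_cball by blast
  have "uniform_limit (cball z d) (\<lambda>n z. \<Sum>i<n. \<eta> ((f ^^ i) z)) (\<lambda>z. \<Sum>n. \<eta> ((f ^^ n) z)) sequentially"
  proof (rule Weierstrass_m_test)
    \<comment> \<open>As \<open>X0\<close> is at least 2, \<open>Re (2 / w) \<ge> 1\<close> holds
      throughout the disc, and one majorant serves all its points.\<close>
    show "summable (\<lambda>n. 4 * C * (1 / (1 + real n / 2)\<^sup>2))"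
      using sum_inverse_squares_bound[of 1] by (intro summable_mult) auto
    show "norm (\<eta> ((f ^^ n) w)) \<le> 4 * C * (1 / (1 + real n / 2)\<^sup>2)" if "w \<in> cball z d" for n w
      using that d X0 by (intro \<eta>_iter_bound) (auto simp: W_def subset_iff)
  qed
  then show "\<exists>d. 0 < d \<and> cball z d \<subseteq> W \<and>
      uniform_limit (cball z d) (\<lambda>n z. \<Sum>i<n. \<eta> ((f ^^ i) z)) (\<lambda>z. \<Sum>n. \<eta> ((f ^^ n) z)) sequentially"
    using d by blast
qed

lemma A_holo_W: "A holomorphic_on W"
proof -
  have "(\<lambda>z. T z + (\<Sum>n. \<eta> ((f ^^ n) z))) holomorphic_on W"
    using T_holo W_subset correction_holo_W
    by (auto intro!: holomorphic_on_add intro: holomorphic_on_subset)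
  then show ?thesis
    by (rule holomorphic_transform) (simp add: W_sums)
qed

lemma A_limit:
  assumes "z \<in> half_strip"
  shows "(\<lambda>n. T ((f ^^ n) z) - of_nat n) \<longlonglongrightarrow> A z"
proof -
  obtain m where "(f ^^ m) z \<in> W" using iter_enters_W[OF assms] .
  from W_sums(2)[OF this]
  have "(\<lambda>n. T ((f ^^ (n + m)) z) - of_nat n - of_nat m) \<longlonglongrightarrow> A ((f ^^ m) z) - of_nat m"
    by (intro tendsto_intros) (simp add: funpow_add)
  then have "(\<lambda>n. T ((f ^^ (n + m)) z) - of_nat (n + m)) \<longlonglongrightarrow> A ((f ^^ m) z) - of_nat m"
    by (simp add: algebra_simps)
  then have l: "(\<lambda>n. T ((f ^^ n) z) - of_nat n) \<longlonglongrightarrow> A ((f ^^ m) z) - of_nat m"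
    by (rule LIMSEQ_offset)
  then show ?thesis
    using limI[OF l] by (simp add: A_def)
qed

lemma A_iter:
  assumes "z \<in> half_strip"
  shows "A ((f ^^ n) z) = A z + of_nat n"
proof -
  have "(\<lambda>k. T ((f ^^ (k + n)) z) - of_nat (k + n)) \<longlonglongrightarrow> A z"
    using A_limit[OF assms] by (rule LIMSEQ_ignore_initial_segment)
  moreover have "(\<lambda>k. T ((f ^^ (k + n)) z) - of_nat k - of_nat n) \<longlonglongrightarrow> A ((f ^^ n) z) - of_nat n"
    using A_limit[OF half_strip_iter[OF assms, of n]]
    by (intro tendsto_intros) (simp add: funpow_add)
  ultimately have "A z = A ((f ^^ n) z) - of_nat n"
    by (intro LIMSEQ_unique) (auto simp: diff_diff_eq)
  then show ?thesis by simp
qed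

text \<open>Holomorphy on \<open>W\<close> is pulled back along \<open>A z = A (f^m z) - m\<close>.
  The number \<open>m\<close> depends on \<open>z\<close>, so this is done on a neighbourhood
  \<open>U\<close> of each point.\<close>

lemma A_holo: "A holomorphic_on half_strip"
proof -
  have "A field_differentiable at z" if z: "z \<in> half_strip" for z
  proof -
    obtain m where m: "(f ^^ m) z \<in> W" using iter_enters_W[OF z] .
    define U where "U = half_strip \<inter> (f ^^ m) -` W"
    have "continuous_on half_strip (f ^^ m)"
      using iter_holo by (rule holomorphic_on_imp_continuous_on)
    then have "open U"
      unfolding U_def using open_half_strip open_W by (rule continuous_open_preimage)
    have "(A \<circ> (f ^^ m)) holomorphic_on U"
      using A_holo_W iter_holo
      by (intro holomorphic_on_compose) (auto intro: holomorphic_on_subset simp: U_def)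
    then have "(\<lambda>w. A ((f ^^ m) w) - of_nat m) holomorphic_on U"
      by (auto intro!: holomorphic_intros simp: o_def)
    then have "A holomorphic_on U"
      by (rule holomorphic_transform) (simp add: A_iter U_def)
    then show ?thesis
      using z m \<open>open U\<close> by (auto simp: U_def intro: holomorphic_on_imp_differentiable_at)
  qed
  then show ?thesis
    using open_half_strip by (simp add: holomorphic_on_open field_differentiable_def)
qed

end

section \<open>Logarithmic asymptotics along orbits\<close>

lemma Ln_over_tendsto_0:
  fixes u :: "nat \<Rightarrow> complex"
  assumes "filterlim (\<lambda>n. norm (u n)) at_top sequentially"
  shows "(\<lambda>n. Ln (u n) / u n) \<longlonglongrightarrow> 0"
proof -
  have "((\<lambda>x::real. (ln x + pi) / x) \<longlongrightarrow> 0) at_top"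
    by real_asymp
  from filterlim_compose[OF this assms]
  have l: "(\<lambda>n. (ln (norm (u n)) + pi) / norm (u n)) \<longlonglongrightarrow> 0" .
  have "eventually (\<lambda>n. 1 \<le> norm (u n)) sequentially"
    using assms by (simp add: filterlim_at_top)
  then have "eventually (\<lambda>n. norm (Ln (u n) / u n) \<le> (ln (norm (u n)) + pi) / norm (u n)) sequentially"
  proof eventually_elim
    case (elim n)
    then have nz: "u n \<noteq> 0" by auto
    have "norm (Ln (u n)) \<le> \<bar>Re (Ln (u n))\<bar> + \<bar>Im (Ln (u n))\<bar>"
      by (rule cmod_le)
    also have "\<bar>Im (Ln (u n))\<bar> \<le> pi"
      using mpi_less_Im_Ln[OF nz] Im_Ln_le_pi[OF nz] by linarith
    also have "\<bar>Re (Ln (u n))\<bar> = ln (norm (u n))"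
      using nz elim by simp
    finally show ?case
      by (simp add: norm_divide divide_right_mono)
  qed
  then show ?thesis
    by (rule Lim_null_comparison[OF _ l])
qed

context parabolic_germ
begin

lemma iter_Re_at_top:
  assumes "z \<in> half_strip"
  shows "filterlim (\<lambda>n. Re (2 / (f ^^ n) z)) at_top sequentially"
proof -
  obtain m where m: "(f ^^ m) z \<in> W" using iter_enters_W[OF assms] .
  have "filterlim (\<lambda>n. x + real n / 2) at_top sequentially" for x
    by real_asymp
  then have "filterlim (\<lambda>n. Re (2 / (f ^^ m) z) + real n / 2) at_top sequentially" .
  then have "filterlim (\<lambda>n. Re (2 / (f ^^ (n + m)) z)) at_top sequentially"
  proof (rule filterlim_at_top_mono, intro always_eventually allI)
    fix n
    show "Re (2 / (f ^^ m) z) + real n / 2 \<le> Re (2 / (f ^^ (n + m)) z)"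
      using iter_W[OF m, of n] by (simp add: funpow_add)
  qed
  then show ?thesis
    unfolding filterlim_at_top
    by (metis (mono_tags, lifting) eventually_mono eventually_sequentially_seg)
qed

lemma norm_at_top_if_Re:
  assumes "filterlim (\<lambda>n. Re (u n)) at_top sequentially"
  shows "filterlim (\<lambda>n. norm (u n)) at_top sequentially"
  by (rule filterlim_at_top_mono[OF assms]) (simp add: complex_Re_le_cmod)

text \<open>The logarithm of \<open>u n = 2 / f^n z\<close> contained in \<open>T\<close> is traded
  for \<open>ln n\<close>: the difference is \<open>Ln (n / u n)\<close>, which tends to 0 because
  \<open>n / u n\<close> tends to 1.\<close>

lemma A_limit_log:
  assumes z: "z \<in> half_strip"
  shows "(\<lambda>n. 2 / (f ^^ n) z - of_nat n - b * of_real (ln (real n))) \<longlonglongrightarrow> A z"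
proof -
  define u where "u n = 2 / (f ^^ n) z" for n
  define t where "t n = T ((f ^^ n) z) - of_nat n" for n
  have T: "T ((f ^^ n) z) = u n - b * Ln (u n)" for n
    by (simp add: T_def u_def)
  have top: "filterlim (\<lambda>n. norm (u n)) at_top sequentially"
    using norm_at_top_if_Re iter_Re_at_top[OF z] by (simp add: u_def)
  have nz: "u n \<noteq> 0" for n
    using half_strip_nonzero[OF half_strip_iter[OF z]] by (simp add: u_def)
  have Re: "0 < Re (u n)" for n
    using half_strip_iter[OF z] Re_reciprocal_pos by (simp add: u_def half_strip_def)
  have t: "t \<longlonglongrightarrow> A z" using A_limit[OF z] by (simp add: t_def[abs_def])
  have "(\<lambda>n. 1 / u n) \<longlonglongrightarrow> 0"
    using tendsto_inverse_0_at_top[OF top]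
    by (subst tendsto_norm_zero_iff[symmetric]) (simp add: norm_divide inverse_eq_divide)
  \<comment> \<open>Dividing \<open>t n = u n - b * Ln (u n) - n\<close> by \<open>u n\<close>
    expresses \<open>n / u n\<close> as 1 plus terms that vanish in the limit.\<close>
  then have "(\<lambda>n. 1 - b * (Ln (u n) / u n) - t n * (1 / u n)) \<longlonglongrightarrow> 1 - b * 0 - A z * 0"
    using Ln_over_tendsto_0[OF top] t by (intro tendsto_intros)
  moreover have "1 - b * (Ln (u n) / u n) - t n * (1 / u n) = of_nat n * inverse (u n)" for n
    using nz[of n] by (simp add: t_def T field_simps)
  ultimately have "(\<lambda>n. of_nat n * inverse (u n)) \<longlonglongrightarrow> 1"
    by simp
  then have "(\<lambda>n. Ln (of_nat n * inverse (u n))) \<longlonglongrightarrow> Ln 1"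
    by (intro tendsto_intros) auto
  then have "(\<lambda>n. t n - b * Ln (of_nat n * inverse (u n))) \<longlonglongrightarrow> A z - b * Ln 1"
    using t by (intro tendsto_diff tendsto_mult tendsto_const)
  moreover have "eventually (\<lambda>n. t n - b * Ln (of_nat n * inverse (u n)) =
      2 / (f ^^ n) z - of_nat n - b * of_real (ln (real n))) sequentially"
    using eventually_gt_at_top[of 0]
  proof eventually_elim
    case (elim n)
    have "u n \<notin> \<real>\<^sub>\<le>\<^sub>0" using Re[of n] by (auto simp: complex_nonpos_Reals_iff)
    then have "Ln (inverse (u n)) = - Ln (u n)"
      using Ln_inverse by blast
    moreover have "Ln (of_nat n * inverse (u n)) = of_real (ln (real n)) + Ln (inverse (u n))"
      using Ln_times_of_real[of "real n" "inverse (u n)"] elim nz[of n] by simp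
    ultimately show ?case
      by (simp add: t_def T) (simp add: u_def algebra_simps)
  qed
  ultimately show ?thesis
    using Lim_transform_eventually by fastforce
qed

text \<open>In the coordinate \<open>u = 2 / z\<close>, \<open>A\<close> becomes
  \<open>u + k u\<close> with \<open>k = s - b Ln\<close>. The derivative of \<open>s\<close> is
  small by Cauchy's estimate on unit discs, that of \<open>b Ln\<close> is \<open>b / u\<close>, and
  a half-plane is convex, so the mean value inequality gives \<open>k\<close> a small Lipschitz
  constant.\<close>

lemma A_near_identity:
  assumes "\<kappa> > 0"
  obtains X where "X0 \<le> X"
    "\<And>z z'. X < Re (2 / z) \<Longrightarrow> X < Re (2 / z') \<Longrightarrow>
       norm (A z - A z' - (2 / z - 2 / z')) \<le> \<kappa> * norm (2 / z - 2 / z')"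
proof -
  \<comment> \<open>The two fractions push \<open>norm (deriv s u)\<close> and
    \<open>norm (b / u)\<close> below \<open>\<kappa> / 2\<close> each; the 1 leaves room for the
    unit discs.\<close>
  define X where "X = X0 + 1 + 32 * C / \<kappa> + 2 * norm b / \<kappa>"
  have X: "X0 + 1 \<le> X" "32 * C / \<kappa> \<le> X - 1" "2 * norm b / \<kappa> \<le> X"
    using assms C_pos X0 by (auto simp: X_def)
  define s where "s u = (\<Sum>n. \<eta> ((f ^^ n) (2 / u)))" for u
  have inW: "2 / u \<in> W" if "X0 < Re u" for u
    using that X0 by (cases "u = 0") (auto simp: W_def)
  have "(\<lambda>u. 2 / u :: complex) holomorphic_on {u. X0 < Re u}"
    using X0 by (intro holomorphic_intros) auto
  then have "((\<lambda>z. \<Sum>n. \<eta> ((f ^^ n) z)) \<circ> (\<lambda>u. 2 / u)) holomorphic_on {u. X0 < Re u}"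
    by (rule holomorphic_on_compose)
      (use inW in \<open>auto intro: holomorphic_on_subset[OF correction_holo_W]\<close>)
  then have s_holo: "s holomorphic_on {u. X0 < Re u}"
    by (simp add: s_def[abs_def] o_def)
  have s_bound: "norm (s u) \<le> 16 * C / Re u" if "X0 < Re u" for u
  proof -
    have "u \<noteq> 0" using that X0 by auto
    then show ?thesis
      using W_sums(4)[OF inW[OF that]] by (simp add: s_def)
  qed
  have op: "open {u. X0 < Re u}"
    by (simp add: open_halfspace_Re_gt)
  define k where "k u = s u - b * Ln u" for u
  have dk: "(k has_field_derivative (deriv s u - b / u)) (at u within {u. X < Re u})"
    if "X < Re u" for u
  proof -
    have "u \<notin> \<real>\<^sub>\<le>\<^sub>0" using that X X0 by (auto simp: complex_nonpos_Reals_iff)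
    moreover have "(s has_field_derivative deriv s u) (at u within {u. X < Re u})"
      using holomorphic_derivI[OF s_holo op, of u] that X by auto
    ultimately show ?thesis
      unfolding k_def[abs_def] by (auto intro!: derivative_eq_intros simp: field_simps)
  qed
  have bk: "norm (deriv s u - b / u) \<le> \<kappa>" if u: "X < Re u" for u
  proof -
    have sub: "cball u 1 \<subseteq> {u. X0 < Re u}"
    proof
      fix v assume "v \<in> cball u 1"
      then have "\<bar>Re (u - v)\<bar> \<le> 1"
        using abs_Re_le_cmod[of "u - v"] by (simp add: dist_norm)
      then show "v \<in> {u. X0 < Re u}" using u X by simp
    qed
    have "norm ((deriv ^^ 1) s u) \<le> fact 1 * (16 * C / (X - 1)) / 1 ^ 1"
    proof (rule Cauchy_inequality)
      show "s holomorphic_on ball u 1"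
        using s_holo sub ball_subset_cball by (meson holomorphic_on_subset order_trans)
      show "continuous_on (cball u 1) s"
        using s_holo sub by (meson holomorphic_on_imp_continuous_on holomorphic_on_subset)
      fix v assume v: "norm (u - v) = 1"
      then have "\<bar>Re (u - v)\<bar> \<le> 1"
        using abs_Re_le_cmod[of "u - v"] by simp
      then have Re_v: "X - 1 \<le> Re v" using u by simp
      have "norm (s v) \<le> 16 * C / Re v"
        using s_bound[of v] sub v by (auto simp: subset_iff dist_norm)
      also have "\<dots> \<le> 16 * C / (X - 1)"
        using Re_v X X0 C_pos by (intro divide_left_mono mult_pos_pos) auto
      finally show "norm (s v) \<le> 16 * C / (X - 1)" .
    qed simp
    also have "\<dots> \<le> \<kappa> / 2"
      using X X0 assms by (simp add: field_simps)
    finally have 1: "norm (deriv s u) \<le> \<kappa> / 2" by simp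
    have "norm b / norm u \<le> norm b / X"
      using u X X0 complex_Re_le_cmod[of u] by (intro divide_left_mono mult_pos_pos) auto
    also have "\<dots> \<le> \<kappa> / 2"
      using X X0 assms by (simp add: field_simps)
    finally show ?thesis
      using 1 norm_triangle_ineq4[of "deriv s u" "b / u"] unfolding norm_divide by linarith
  qed
  have A: "A z = 2 / z + k (2 / z)" if "X < Re (2 / z)" for z
    using W_sums(3)[of z] that X by (simp add: W_def T_def k_def s_def)
  show ?thesis
  proof (rule that)
    show "X0 \<le> X" using X by simp
    fix z z' :: complex assume z: "X < Re (2 / z)" "X < Re (2 / z')"
    have "norm (k (2 / z) - k (2 / z')) \<le> \<kappa> * norm (2 / z - 2 / z')"
      by (rule field_differentiable_bound[of "{u. X < Re u}"])
        (use dk bk z in \<open>auto simp: convex_halfspace_Re_gt\<close>)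
    then show "norm (A z - A z' - (2 / z - 2 / z')) \<le> \<kappa> * norm (2 / z - 2 / z')"
      using A z by simp
  qed
qed

text \<open>Far out, the Lipschitz constant of the deviation of \<open>A\<close> from
  \<open>2 / z\<close> is as small as desired, while \<open>2 / y n - 2 / x n\<close> stays bounded;
  hence the increments of \<open>A\<close> and of \<open>2 / z\<close> have the same limit.\<close>

lemma A_diff_tendsto:
  assumes x: "filterlim (\<lambda>n. Re (2 / x n)) at_top sequentially"
    and yx: "(\<lambda>n. 2 / y n - 2 / x n) \<longlonglongrightarrow> \<tau>"
  shows "(\<lambda>n. A (y n) - A (x n)) \<longlonglongrightarrow> \<tau>"
proof -
  define q where "q n = 2 / y n - 2 / x n" for n
  have "Bseq q"
    using yx convergentI convergent_imp_Bseq unfolding q_def[abs_def] by blast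
  then obtain B where B: "B > 0" "\<And>n. norm (q n) \<le> B"
    by (auto simp: Bseq_def)
  have "(\<lambda>n. A (y n) - A (x n) - q n) \<longlonglongrightarrow> 0"
  proof (rule tendstoI)
    fix e :: real assume "e > 0"
    then have "e / (2 * B) > 0" using B by simp
    then obtain X where X: "\<And>z z'. X < Re (2 / z) \<Longrightarrow> X < Re (2 / z') \<Longrightarrow>
       norm (A z - A z' - (2 / z - 2 / z')) \<le> e / (2 * B) * norm (2 / z - 2 / z')"
      using A_near_identity by blast
    have "eventually (\<lambda>n. X + B < Re (2 / x n)) sequentially"
      using x by (simp add: filterlim_at_top_dense)
    then show "eventually (\<lambda>n. dist (A (y n) - A (x n) - q n) 0 < e) sequentially"
    proof eventually_elim
      case (elim n)
      have "\<bar>Re (q n)\<bar> \<le> B"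
        using abs_Re_le_cmod[of "q n"] B(2)[of n] by linarith
      then have "X < Re (2 / y n)"
        using elim by (simp add: q_def)
      then have "norm (A (y n) - A (x n) - q n) \<le> e / (2 * B) * norm (q n)"
        using X[of "y n" "x n"] elim B(1) by (simp add: q_def)
      also have "\<dots> \<le> e / (2 * B) * B"
        using B \<open>e > 0\<close> by (intro mult_left_mono) auto
      also have "\<dots> < e"
        using B \<open>e > 0\<close> by simp
      finally show ?case by simp
    qed
  qed
  then have "(\<lambda>n. A (y n) - A (x n) - q n + q n) \<longlonglongrightarrow> 0 + \<tau>"
    using yx unfolding q_def[abs_def] by (intro tendsto_intros)
  then show ?thesis by simp
qed

text \<open>Equal values of \<open>A\<close> persist along the two orbits. Both orbits reach the
  region where the deviation of \<open>A\<close> from \<open>2 / z\<close> has Lipschitz constant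
  \<open>1 / 2\<close>; there they must coincide, and \<open>f^n\<close> is injective.\<close>

lemma A_inj: "inj_on A half_strip"
proof (rule inj_onI)
  fix z z' assume z: "z \<in> half_strip" "z' \<in> half_strip" and eq: "A z = A z'"
  obtain X where X: "\<And>z z'. X < Re (2 / z) \<Longrightarrow> X < Re (2 / z') \<Longrightarrow>
       norm (A z - A z' - (2 / z - 2 / z')) \<le> 1 / 2 * norm (2 / z - 2 / z')"
    by (rule A_near_identity[of "1 / 2"]) auto
  have "eventually (\<lambda>n. X < Re (2 / (f ^^ n) z) \<and> X < Re (2 / (f ^^ n) z')) sequentially"
    using iter_Re_at_top[OF z(1)] iter_Re_at_top[OF z(2)]
    unfolding filterlim_at_top_dense by (auto intro: eventually_conj)
  then obtain n where n: "X < Re (2 / (f ^^ n) z)" "X < Re (2 / (f ^^ n) z')"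
    by (auto dest: eventually_happens)
  have "norm (2 / (f ^^ n) z - 2 / (f ^^ n) z') \<le> 1 / 2 * norm (2 / (f ^^ n) z - 2 / (f ^^ n) z')"
    using X[OF n] eq by (simp add: A_iter z norm_minus_commute)
  then have "2 / (f ^^ n) z = 2 / (f ^^ n) z'"
    by simp
  then have "(f ^^ n) z = (f ^^ n) z'"
    using half_strip_nonzero[OF half_strip_iter[OF z(1)]] half_strip_nonzero[OF half_strip_iter[OF z(2)]]
    by (simp add: divide_eq_eq)
  then show "z = z'"
    using iter_inj z by (meson inj_onD)
qed

text \<open>A fixed point of \<open>\<phi>\<close> solves the equation. As \<open>\<phi>\<close> is,
  up to sign and a constant, the deviation of \<open>A\<close> from the identity in the coordinate
  \<open>2 / z\<close>, it contracts by \<open>1 / 2\<close>; it moves the centre \<open>u\<close>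
  by \<open>\<tau>\<close>, so the disc of radius \<open>2 * norm \<tau>\<close> is mapped into
  itself.\<close>

lemma A_translate:
  obtains X where "2 \<le> X"
    "\<And>z. X < Re (2 / z) \<Longrightarrow> \<exists>z'. A z' = A z + \<tau> \<and> norm (2 / z' - 2 / z) \<le> 2 * norm \<tau>"
proof -
  obtain X where X: "X0 \<le> X" "\<And>z z'. X < Re (2 / z) \<Longrightarrow> X < Re (2 / z') \<Longrightarrow>
       norm (A z - A z' - (2 / z - 2 / z')) \<le> 1 / 2 * norm (2 / z - 2 / z')"
    by (rule A_near_identity[of "1 / 2"]) auto
  show ?thesis
  proof (rule that)
    show "2 \<le> X + 2 * norm \<tau>" using X X0 by (simp add: add_increasing2)
    fix z :: complex assume z: "X + 2 * norm \<tau> < Re (2 / z)"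
    define u where "u = 2 / z"
    define \<phi> where "\<phi> v = v - (A (2 / v) - A z - \<tau>)" for v
    have Re: "X < Re v" if "v \<in> cball u (2 * norm \<tau>)" for v
      using that z abs_Re_le_cmod[of "u - v"] by (auto simp: dist_norm u_def)
    have contr: "dist (\<phi> v) (\<phi> w) \<le> 1 / 2 * dist v w"
      if "v \<in> cball u (2 * norm \<tau>)" "w \<in> cball u (2 * norm \<tau>)" for v w
    proof -
      have "v \<noteq> 0" "w \<noteq> 0" using Re[OF that(1)] Re[OF that(2)] X X0 by auto
      then have "norm (A (2 / v) - A (2 / w) - (v - w)) \<le> 1 / 2 * norm (v - w)"
        using X(2)[of "2 / v" "2 / w"] Re[OF that(1)] Re[OF that(2)] by simp
      moreover have "\<phi> v - \<phi> w = - (A (2 / v) - A (2 / w) - (v - w))"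
        by (simp add: \<phi>_def)
      ultimately show ?thesis
        by (simp only: dist_norm norm_minus_cancel)
    qed
    have u: "u \<in> cball u (2 * norm \<tau>)" by simp
    have "z \<noteq> 0" using z X X0 norm_ge_zero[of \<tau>] by (cases "z = 0") auto
    then have \<phi>u: "\<phi> u = u + \<tau>" by (simp add: \<phi>_def u_def)
    have "\<exists>!v\<in>cball u (2 * norm \<tau>). \<phi> v = v"
    proof (rule Banach_fix[where c="1/2"])
      show "\<phi> ` cball u (2 * norm \<tau>) \<subseteq> cball u (2 * norm \<tau>)"
      proof clarify
        fix v assume v: "v \<in> cball u (2 * norm \<tau>)"
        have "dist u (\<phi> v) \<le> dist u (\<phi> u) + dist (\<phi> u) (\<phi> v)"
          by (rule dist_triangle)
        also have "\<dots> \<le> norm \<tau> + 1 / 2 * dist u v"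
          using contr[OF u v] by (simp add: \<phi>u dist_norm)
        also have "\<dots> \<le> 2 * norm \<tau>" using v by simp
        finally show "\<phi> v \<in> cball u (2 * norm \<tau>)" by simp
      qed
    qed (use contr in \<open>auto simp: compact_imp_complete\<close>)
    then obtain v where v: "v \<in> cball u (2 * norm \<tau>)" "\<phi> v = v" by blast
    show "\<exists>z'. A z' = A z + \<tau> \<and> norm (2 / z' - 2 / z) \<le> 2 * norm \<tau>"
    proof (intro exI[of _ "2 / v"] conjI)
      show "A (2 / v) = A z + \<tau>"
        using v(2) by (simp add: \<phi>_def algebra_simps)
      show "norm (2 / (2 / v) - 2 / z) \<le> 2 * norm \<tau>"
        using v(1) by (simp add: dist_norm u_def norm_minus_commute)
    qed
  qed
qed

end

subsection \<open>Regular iterates\<close>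

definition sector :: "complex set" where
  "sector = {z. 0 < Re z \<and> \<bar>Im z\<bar> < pi \<and> \<bar>Im z\<bar> < Re z}"

lemma sector_subset: "sector \<subseteq> half_strip"
  by (auto simp: sector_def half_strip_def)

lemma sector_eq_halfspaces:
  "sector = {z. 0 < Re z} \<inter> {z. Im z < pi} \<inter> {z. - pi < Im z}
     \<inter> {z. Re (\<i> * z + z) > 0} \<inter> {z. Re (z - \<i> * z) > 0}"
  by (auto simp: sector_def)

lemma open_sector: "open sector"
  unfolding sector_eq_halfspaces
  by (intro open_Int open_halfspace_Re_gt open_halfspace_Im_lt open_halfspace_Im_gt
      open_Collect_less continuous_intros)

lemma convex_sector: "convex sector"
proof (rule convexI)
  fix x y :: complex and u v :: real
  assume *: "x \<in> sector" "y \<in> sector" "0 \<le> u" "0 \<le> v" "u + v = 1"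
  have pos: "0 < u * a + v * c" if "0 < a" "0 < c" for a c :: real
  proof (cases "u = 0")
    case False
    then have "0 < u * a" "0 \<le> v * c" using * that by auto
    then show ?thesis by (rule add_pos_nonneg)
  qed (use * that in auto)
  have "0 < u * Re x + v * Re y"
    using * by (intro pos) (auto simp: sector_def)
  moreover have "0 < u * (pi - Im x) + v * (pi - Im y)"
    using * by (intro pos) (auto simp: sector_def)
  moreover have "0 < u * (pi + Im x) + v * (pi + Im y)"
    using * by (intro pos) (auto simp: sector_def)
  moreover have "0 < u * (Re x - Im x) + v * (Re y - Im y)"
    using * by (intro pos) (auto simp: sector_def)
  moreover have "0 < u * (Re x + Im x) + v * (Re y + Im y)"
    using * by (intro pos) (auto simp: sector_def)
  moreover have "u * pi + v * pi = pi"
    using * by (metis distrib_right mult_1)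
  ultimately show "u *\<^sub>R x + v *\<^sub>R y \<in> sector"
    by (simp add: sector_def abs_less_iff distrib_left right_diff_distrib)
qed

lemma of_real_in_sector: "0 < x \<Longrightarrow> of_real x \<in> sector"
  by (simp add: sector_def)

text \<open>The opening angle gives \<open>norm z \<le> 2 * Re z\<close>, and
  \<open>Re (2 / z)\<close> is \<open>2 * Re z\<close> divided by the squared norm.\<close>

lemma sector_Re_reciprocal:
  assumes "z \<in> sector"
  shows "1 / norm z \<le> Re (2 / z)"
proof -
  have "norm z \<le> 2 * Re z"
    using cmod_le[of z] assms by (auto simp: sector_def)
  moreover have "norm z > 0" using assms by (auto simp: sector_def)
  ultimately have "1 / norm z \<le> 2 * Re z / (norm z)\<^sup>2"
    by (simp add: field_simps power2_eq_square)
  then show ?thesis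
    by (simp add: Re_divide cmod_power2)
qed

text \<open>Inversion preserves \<open>|Im| < Re\<close>, so it suffices to locate
  \<open>2 / z\<close>; the summand 2 yields \<open>Re (2 / z) > 2\<close>, which places
  \<open>z\<close> in \<open>half_strip\<close>.\<close>

lemma near_real_in_sector:
  fixes z :: complex
  assumes "norm (2 / z - of_real u) \<le> d" "2 * d + 2 < u"
  shows "z \<in> sector"
proof -
  define v where "v = 2 / z"
  have "\<bar>Re (v - of_real u)\<bar> \<le> d" "\<bar>Im (v - of_real u)\<bar> \<le> d"
    using assms(1) abs_Re_le_cmod[of "v - of_real u"] abs_Im_le_cmod[of "v - of_real u"]
    by (auto simp: v_def)
  then have v: "\<bar>Im v\<bar> < Re v" "2 < Re v"
    using assms(2) by auto
  have "z = 2 / v" using v by (cases "z = 0") (auto simp: v_def)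
  moreover have "0 < (Re v)\<^sup>2 + (Im v)\<^sup>2" using v by (simp add: sum_power2_gt_zero_iff)
  ultimately have "\<bar>Im z\<bar> < Re z"
    using v by (simp add: Re_divide Im_divide abs_mult divide_strict_right_mono)
  moreover have "z \<in> half_strip"
    using half_strip_near_0[of 2 z] v by (simp add: v_def)
  ultimately show ?thesis by (auto simp: sector_def half_strip_def)
qed

section \<open>The flow on the sector and its asymptotic expansion\<close>

context parabolic_germ
begin

definition flow :: "complex \<Rightarrow> complex \<Rightarrow> complex" where
  "flow \<tau> z = inv_into sector A (\<tau> + A z)"

definition flow_dom :: "complex \<Rightarrow> complex set" where
  "flow_dom \<tau> = {z \<in> sector. \<tau> + A z \<in> A ` sector}"

lemma A_inj_sector: "inj_on A sector"
  using A_inj sector_subset by (rule inj_on_subset)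

lemma flow_props:
  assumes "z \<in> flow_dom \<tau>"
  shows "flow \<tau> z \<in> sector" "A (flow \<tau> z) = \<tau> + A z"
  using assms unfolding flow_dom_def flow_def
  by (auto intro: inv_into_into f_inv_into_f)

lemma flow_dom_limpt: "0 islimpt flow_dom \<tau>"
proof -
  obtain X where X: "2 \<le> X" "\<And>z. X < Re (2 / z) \<Longrightarrow> \<exists>z'. A z' = A z + \<tau> \<and> norm (2 / z' - 2 / z) \<le> 2 * norm \<tau>"
    using A_translate[of \<tau>] by blast
  show ?thesis
    unfolding islimpt_approachable
  proof (intro allI impI)
    fix e :: real assume "e > 0"
    \<comment> \<open>The terms serve \<open>A_translate\<close>, \<open>near_real_in_sector\<close>
      with radius \<open>2 * norm \<tau>\<close>, and the distance \<open>e\<close>, in this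
      order.\<close>
    define u where "u = max X (4 * norm \<tau> + 2) + 2 / e + 1"
    have "0 < 2 / e" using \<open>e > 0\<close> by simp
    then have u: "X < u" "4 * norm \<tau> + 2 < u" "2 / e < u" "0 < u"
      using X norm_ge_zero[of \<tau>] unfolding u_def by linarith+
    define x :: complex where "x = of_real (2 / u)"
    have x: "2 / x = of_real u" using u by (simp add: x_def)
    obtain z' where z': "A z' = A x + \<tau>" "norm (2 / z' - of_real u) \<le> 2 * norm \<tau>"
      using X(2)[of x] x u by auto
    then have "z' \<in> sector"
      using u by (intro near_real_in_sector[of z' u "2 * norm \<tau>"]) auto
    moreover have "x \<in> sector"
      using u unfolding x_def by (intro of_real_in_sector) auto
    ultimately have "x \<in> flow_dom \<tau>"
      using z'(1) by (auto simp: flow_dom_def add.commute intro!: rev_image_eqI)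
    moreover have "x \<noteq> 0" "dist x 0 < e"
      using u \<open>e > 0\<close> by (auto simp: x_def norm_divide field_simps)
    ultimately show "\<exists>x'\<in>flow_dom \<tau>. x' \<noteq> 0 \<and> dist x' 0 < e" by blast
  qed
qed

text \<open>The increment \<open>A (\<phi> z) - A z\<close> is \<open>f\<close>-invariant up to \<open>O(z\<^sup>N\<^sup>+\<^sup>3)\<close>, since passing to the
  coordinate \<open>2 / z\<close> costs two orders. It tends to \<open>\<tau>\<close> along the orbit of \<open>z\<close>, so summing the errors
  over the orbit bounds its distance from \<open>\<tau>\<close>.\<close>

lemma A_increment_of_almost_commuting:
  assumes "tangent_to_identity \<phi> P" and P2: "P $ 2 = - \<tau> / 2"
    and comm: "\<And>k. k < N + 5 \<Longrightarrow> (P oo F) $ k = (F oo P) $ k"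
  obtains K X where "0 \<le> K" "2 \<le> X"
    "\<And>z. X < Re (2 / z) \<Longrightarrow> norm (A (\<phi> z) - A z - \<tau>) \<le> K * (2 / Re (2 / z)) ^ (N + 1)"
    "\<And>z. X < Re (2 / z) \<Longrightarrow> norm (2 / \<phi> z - 2 / z) \<le> norm \<tau> + 1"
proof -
  interpret \<phi>: tangent_to_identity \<phi> P by fact
  obtain C1 r1 where C1: "C1 > 0" "r1 > 0"
    "\<And>z. norm z < r1 \<Longrightarrow> z \<noteq> 0 \<Longrightarrow> \<phi> z \<noteq> 0 \<and> norm (2 / \<phi> z - 2 / z + 2 * P $ 2) \<le> C1 * norm z"
    using \<phi>.reciprocal_expansion by blast
  obtain r2 where r2: "r2 > 0" "\<And>z. norm z < r2 \<Longrightarrow> norm z / 2 \<le> norm (\<phi> z)"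
    using \<phi>.norm_ge_half by blast
  obtain r3 where r3: "r3 > 0" "\<And>z. norm z < r3 \<Longrightarrow> norm z / 2 \<le> norm (f z)"
    using norm_ge_half by blast
  define k where "k z = (\<phi> \<circ> f) z - (f \<circ> \<phi>) z" for z
  have "k has_fps_expansion (P oo F) - (F oo P)"
    unfolding k_def[abs_def]
    using fps \<phi>.fps F0 \<phi>.F0 by (intro has_fps_expansion_diff has_fps_expansion_compose) auto
  moreover have "((P oo F) - (F oo P)) $ i = 0" if "i < N + 5" for i
    using comm[OF that] by simp
  ultimately obtain C2 r4 where C2: "C2 > 0" "r4 > 0"
    "\<And>z. norm z < r4 \<Longrightarrow> norm (k z) \<le> C2 * norm z ^ (N + 5)"
    by (rule has_fps_expansion_bound) blast+
  obtain X1 where X1: "X0 \<le> X1"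
    "\<And>z z'. X1 < Re (2 / z) \<Longrightarrow> X1 < Re (2 / z') \<Longrightarrow>
       norm (A z - A z' - (2 / z - 2 / z')) \<le> 1 * norm (2 / z - 2 / z')"
    by (rule A_near_identity[OF zero_less_one]) blast
  define r where "r = min (min r1 r2) (min r3 r4)"
  have r: "r > 0" "r \<le> r1" "r \<le> r2" "r \<le> r3" "r \<le> r4"
    using C1 r2 r3 C2 by (auto simp: r_def)
  define Y where "Y = max X1 (2 / r)"
  have Y: "X0 \<le> Y" "X1 \<le> Y" "2 / r \<le> Y" "2 \<le> Y" using X1 X0 by (auto simp: Y_def)
  have Y_small: "norm z < r" "z \<noteq> 0" "z \<in> W" if "Y < Re (2 / z)" for z
  proof -
    have "norm z \<le> 2 / Re (2 / z)"
      using that Y by (intro norm_le_Re_reciprocal) auto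
    also have "\<dots> < 2 / Y"
      using that Y by (intro divide_strict_left_mono mult_pos_pos) auto
    also have "\<dots> \<le> r"
      using Y r by (simp add: field_simps)
    finally show "norm z < r" .
    show "z \<noteq> 0" using that Y by auto
    show "z \<in> W" using that Y by (auto simp: W_def)
  qed
  have f_Y: "Y < Re (2 / f z)" if "Y < Re (2 / z)" for z
    using iter_W[OF Y_small(3)[OF that], of 1] that by simp
  \<comment> \<open>The slack \<open>norm \<tau> + 1\<close> keeps \<open>\<phi> z\<close> beyond
    \<open>Y\<close> after a move of that length; \<open>2 * C1\<close> makes the error
    \<open>C1 * norm z\<close> at most 1.\<close>
  define X where "X = Y + norm \<tau> + 1 + 2 * C1"
  have X: "Y \<le> X" "2 * C1 \<le> X" "2 \<le> X"
    using Y C1(1) norm_ge_zero[of \<tau>] unfolding X_def by linarith+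
  have \<phi>_step: "norm (2 / \<phi> z - 2 / z - \<tau>) \<le> C1 * norm z"
      "norm (2 / \<phi> z - 2 / z) \<le> norm \<tau> + 1" "Y < Re (2 / \<phi> z)" if "X < Re (2 / z)" for z
  proof -
    have zY: "Y < Re (2 / z)" using that X by simp
    show 1: "norm (2 / \<phi> z - 2 / z - \<tau>) \<le> C1 * norm z"
      using C1(3)[of z] Y_small[OF zY] r P2 by simp
    have "norm z \<le> 2 / X"
      using that X by (intro norm_le_Re_reciprocal) auto
    then have "C1 * norm z \<le> C1 * (2 / X)"
      using C1 by (intro mult_left_mono) auto
    also have "\<dots> \<le> 1" using X by (simp add: field_simps)
    finally show 2: "norm (2 / \<phi> z - 2 / z) \<le> norm \<tau> + 1"
      using 1 norm_triangle_ineq[of "2 / \<phi> z - 2 / z - \<tau>" \<tau>] by simp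
    then have "\<bar>Re (2 / \<phi> z - 2 / z)\<bar> \<le> norm \<tau> + 1"
      using abs_Re_le_cmod order_trans by blast
    then show "Y < Re (2 / \<phi> z)"
      using that C1(1) by (simp add: X_def abs_le_iff)
  qed
  have f_X: "X < Re (2 / f z)" if "X < Re (2 / z)" for z
    using iter_W[OF Y_small(3), of z 1] that X by simp
  define e where "e z = A (\<phi> z) - A z" for z
  have e_step: "norm (e (f z) - e z) \<le> 64 * C2 * norm z ^ (N + 3)" if zX: "X < Re (2 / z)" for z
  proof -
    have zY: "Y < Re (2 / z)" using zX X by simp
    have fz: "X < Re (2 / f z)" using f_X[OF zX] .
    note pY = \<phi>_step(3)[OF zX]
    have "A (f z) = A z + 1" "A (f (\<phi> z)) = A (\<phi> z) + 1"
      using A_iter[of z 1] A_iter[of "\<phi> z" 1] W_subset[OF Y_small(3)[OF zY]] W_subset[OF Y_small(3)[OF pY]]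
      by auto
    \<comment> \<open>Invariance of the increment fails exactly by the commutator of
      \<open>\<phi>\<close> and \<open>f\<close>, as measured by \<open>A\<close>.\<close>
    then have "e (f z) - e z = A (\<phi> (f z)) - A (f (\<phi> z))"
      by (simp add: e_def)
    moreover have "norm (A (\<phi> (f z)) - A (f (\<phi> z))) \<le> 2 * norm (2 / \<phi> (f z) - 2 / f (\<phi> z))"
    proof -
      have "norm (A (\<phi> (f z)) - A (f (\<phi> z)) - (2 / \<phi> (f z) - 2 / f (\<phi> z)))
          \<le> norm (2 / \<phi> (f z) - 2 / f (\<phi> z))"
        using X1(2)[of "\<phi> (f z)" "f (\<phi> z)"] \<phi>_step(3)[OF fz] f_Y[OF pY] Y by simp
      then show ?thesis
        using norm_triangle_sub[of "A (\<phi> (f z)) - A (f (\<phi> z))" "2 / \<phi> (f z) - 2 / f (\<phi> z)"] by simp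
    qed
    moreover have "norm (2 / \<phi> (f z) - 2 / f (\<phi> z)) \<le> 32 * C2 * norm z ^ (N + 3)"
    proof -
      have n: "norm z / 2 \<le> norm (f z)" "norm (f z) / 2 \<le> norm (\<phi> (f z))"
        "norm z / 2 \<le> norm (\<phi> z)" "norm (\<phi> z) / 2 \<le> norm (f (\<phi> z))"
        using r2(2) r3(2) Y_small(1)[OF zY] Y_small(1)[OF f_Y[OF zY]] Y_small(1)[OF pY] r by auto
      have pos: "norm z > 0" using Y_small[OF zY] by simp
      then have nz: "\<phi> (f z) \<noteq> 0" "f (\<phi> z) \<noteq> 0"
        using n by auto
      have "norm z / 4 * (norm z / 4) \<le> norm (\<phi> (f z)) * norm (f (\<phi> z))"
        using n by (intro mult_mono) auto
      moreover have "2 / \<phi> (f z) - 2 / f (\<phi> z) = - 2 * k z / (\<phi> (f z) * f (\<phi> z))"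
        using nz by (simp add: k_def field_simps)
      then have "norm (2 / \<phi> (f z) - 2 / f (\<phi> z)) = 2 * norm (k z) / (norm (\<phi> (f z)) * norm (f (\<phi> z)))"
        by (simp add: norm_divide norm_mult)
      moreover have "norm (k z) \<le> C2 * norm z ^ (N + 5)"
        using C2(3)[of z] Y_small(1)[OF zY] r by simp
      ultimately have "norm (2 / \<phi> (f z) - 2 / f (\<phi> z)) \<le>
          2 * (C2 * norm z ^ (N + 5)) / (norm z / 4 * (norm z / 4))"
        using pos C2(1) by (simp only:) (intro frac_le mult_left_mono; simp)
      also have "\<dots> = 32 * C2 * norm z ^ (N + 3)"
        using pos by (simp add: field_simps power_add eval_nat_numeral)
      finally show ?thesis .
    qed
    ultimately show ?thesis by simp
  qed
  define K where "K = 64 * C2 * 16"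
  have bound: "norm (e z - \<tau>) \<le> K * (2 / Re (2 / z)) ^ (N + 1)" if zX: "X < Re (2 / z)" for z
  proof -
    define x where "x = Re (2 / z)"
    have x: "1 \<le> x" "X < x" using zX X by (auto simp: x_def)
    have zW: "z \<in> W" using Y_small[of z] zX X by simp
    have iter: "X < Re (2 / (f ^^ n) z)" "x + real n / 2 \<le> Re (2 / (f ^^ n) z)" for n
      using iter_W[OF zW, of n] x by (auto simp: x_def)
    have nz: "norm ((f ^^ n) z) \<le> 2 / (x + real n / 2)" for n
      using iter[of n] x by (intro norm_le_Re_reciprocal) auto
    \<comment> \<open>Of the \<open>N + 3\<close> factors, \<open>N + 1\<close> are bounded by the
      initial value \<open>2 / x\<close> and two supply the summable inverse square.\<close>
    have d: "norm (e ((f ^^ Suc n) z) - e ((f ^^ n) z)) \<le>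
        64 * C2 * (2 / x) ^ (N + 1) * 4 * (1 / (x + real n / 2)\<^sup>2)" for n
    proof -
      have "2 / (x + real n / 2) \<le> 2 / x"
        using x by (intro divide_left_mono) auto
      then have "norm ((f ^^ n) z) \<le> 2 / x"
        using nz[of n] by linarith
      then have "norm ((f ^^ n) z) ^ (N + 1) * norm ((f ^^ n) z) ^ 2 \<le>
          (2 / x) ^ (N + 1) * (2 / (x + real n / 2)) ^ 2"
        using nz[of n] x by (intro mult_mono power_mono) auto
      moreover have "norm ((f ^^ n) z) ^ (N + 3) = norm ((f ^^ n) z) ^ (N + 1) * norm ((f ^^ n) z) ^ 2"
        unfolding power_add[symmetric] by (simp add: eval_nat_numeral)
      moreover have "(2 / (x + real n / 2)) ^ 2 = 4 * (1 / (x + real n / 2)\<^sup>2)"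
        by (simp add: power_divide)
      ultimately have "norm ((f ^^ n) z) ^ (N + 3) \<le> (2 / x) ^ (N + 1) * 4 * (1 / (x + real n / 2)\<^sup>2)"
        by (simp only: mult.assoc)
      then have "64 * C2 * norm ((f ^^ n) z) ^ (N + 3) \<le>
          64 * C2 * ((2 / x) ^ (N + 1) * 4 * (1 / (x + real n / 2)\<^sup>2))"
        using C2 by (intro mult_left_mono) auto
      then show ?thesis
        using e_step[OF iter(1), of n] by (simp add: mult.assoc)
    qed
    note sb = sum_inverse_squares_bound[OF x(1)]
    have part: "norm (e ((f ^^ n) z) - e z) \<le> K * (2 / x) ^ (N + 1)" for n
    proof -
      have "norm (e ((f ^^ n) z) - e z) = norm (\<Sum>i<n. e ((f ^^ Suc i) z) - e ((f ^^ i) z))"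
        by (subst sum_lessThan_telescope) simp
      also have "\<dots> \<le> (\<Sum>i<n. 64 * C2 * (2 / x) ^ (N + 1) * 4 * (1 / (x + real i / 2)\<^sup>2))"
        by (intro sum_norm_le d)
      also have "\<dots> = 64 * C2 * (2 / x) ^ (N + 1) * 4 * (\<Sum>i<n. 1 / (x + real i / 2)\<^sup>2)"
        by (simp add: sum_distrib_left)
      also have "\<dots> \<le> 64 * C2 * (2 / x) ^ (N + 1) * 4 * 4"
      proof (intro mult_left_mono)
        have "(\<Sum>i<n. 1 / (x + real i / 2)\<^sup>2) \<le> (\<Sum>i. 1 / (x + real i / 2)\<^sup>2)"
          using sb by (intro sum_le_suminf) auto
        also have "\<dots> \<le> 4 / x" by (rule sb(2))
        also have "\<dots> \<le> 4" using x by (simp add: field_simps)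
        finally show "(\<Sum>i<n. 1 / (x + real i / 2)\<^sup>2) \<le> 4" .
      qed (use C2 x in auto)
      finally show ?thesis by (simp add: K_def)
    qed
    \<comment> \<open>The limit along the orbit is computed in the coordinate \<open>2 / z\<close>,
      where \<open>\<phi>\<close> is translation by \<open>\<tau>\<close> up to \<open>O(z)\<close>,
      and then carried over to \<open>A\<close>.\<close>
    have "(\<lambda>n. 2 / \<phi> ((f ^^ n) z) - 2 / (f ^^ n) z - \<tau>) \<longlonglongrightarrow> 0"
    proof (rule Lim_null_comparison)
      show "eventually (\<lambda>n. norm (2 / \<phi> ((f ^^ n) z) - 2 / (f ^^ n) z - \<tau>) \<le>
          C1 * (2 / (x + real n / 2))) sequentially"
        using \<phi>_step(1)[OF iter(1)] nz C1
        by (intro always_eventually allI) (meson mult_left_mono order_less_imp_le order_trans)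
      have "(\<lambda>n. 2 / (x + real n / 2)) \<longlonglongrightarrow> 0" by real_asymp
      from tendsto_mult_right_zero[OF this]
      show "(\<lambda>n. C1 * (2 / (x + real n / 2))) \<longlonglongrightarrow> 0" .
    qed
    then have "(\<lambda>n. 2 / \<phi> ((f ^^ n) z) - 2 / (f ^^ n) z) \<longlonglongrightarrow> \<tau>"
      by (simp add: LIM_zero_iff)
    then have "(\<lambda>n. e ((f ^^ n) z)) \<longlonglongrightarrow> \<tau>"
      unfolding e_def using iter_Re_at_top[OF W_subset[OF zW]] by (intro A_diff_tendsto)
    then have "(\<lambda>n. norm (e ((f ^^ n) z) - e z)) \<longlonglongrightarrow> norm (\<tau> - e z)"
      by (intro tendsto_intros)
    then have "norm (\<tau> - e z) \<le> K * (2 / x) ^ (N + 1)"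
      by (rule tendsto_upperbound) (use part in auto)
    then show ?thesis by (simp add: x_def norm_minus_commute)
  qed
  show ?thesis
    by (rule that[of K X]) (use C2 X \<phi>_step(2) bound in \<open>auto simp: K_def e_def\<close>)
qed

end

lemma smallo_power_if_bound:
  assumes "r > 0" and le: "\<And>z. z \<in> S \<Longrightarrow> norm z < r \<Longrightarrow> norm (g z) \<le> K * norm z ^ (N + 1)"
  shows "g \<in> o[at 0 within S](\<lambda>z::complex. z ^ N :: complex)"
proof (rule landau_o.smallI)
  fix c :: real assume "c > 0"
  define d where "d = min r (c / (\<bar>K\<bar> + 1))"
  have "d > 0" using assms(1) \<open>c > 0\<close> by (simp add: d_def)
  moreover have "norm (g z) \<le> c * norm (z ^ N)" if "z \<in> S" "norm z < d" for z
  proof -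
    have "norm (g z) \<le> K * norm z ^ (N + 1)"
      using le that by (simp add: d_def)
    also have "\<dots> \<le> (\<bar>K\<bar> + 1) * norm z * norm z ^ N"
      by (simp add: mult.assoc mult_right_mono)
    also have "(\<bar>K\<bar> + 1) * norm z \<le> c"
      using that(2) by (simp add: d_def field_simps)
    finally show ?thesis by (simp add: norm_power mult_right_mono)
  qed
  ultimately show "eventually (\<lambda>z. norm (g z) \<le> c * norm (z ^ N)) (at 0 within S)"
    unfolding eventually_at by (intro exI[of _ d]) auto
qed

lemma partial_sum_has_fps_expansion:
  "(\<lambda>z::complex. \<Sum>n\<le>M. \<Phi> $ n * z ^ n) has_fps_expansion (\<Sum>n\<le>M. fps_const (\<Phi> $ n) * fps_X ^ n)"
  by (intro fps_expansion_intros)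

lemma fps_nth_partial_sum:
  "(\<Sum>n\<le>M. fps_const (\<Phi> $ n) * fps_X ^ n) $ k = (if k \<le> M then \<Phi> $ k else 0)"
  for \<Phi> :: "complex fps"
  by (simp add: fps_sum_nth if_distrib[of "(*) _"] fps_X_power_nth cong: if_cong)

context parabolic_germ
begin

text \<open>\<open>flow\<close> selects the preimage in \<open>sector\<close>, while
  \<open>A_translate\<close> finds one close to \<open>z\<close>. Both lie in
  \<open>half_strip\<close>, where \<open>A\<close> is injective, so they coincide.\<close>

lemma flow_near_0:
  obtains X where "2 \<le> X"
    "\<And>z. z \<in> flow_dom \<tau> \<Longrightarrow> X < Re (2 / z) \<Longrightarrow> norm (2 / flow \<tau> z - 2 / z) \<le> 2 * norm \<tau>"
proof -
  obtain X where X: "2 \<le> X" "\<And>z. X < Re (2 / z) \<Longrightarrow> \<exists>z'. A z' = A z + \<tau> \<and> norm (2 / z' - 2 / z) \<le> 2 * norm \<tau>"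
    using A_translate[of \<tau>] by blast
  show ?thesis
  proof (rule that)
    show "2 \<le> X + 2 * norm \<tau>" using X by (simp add: add_increasing2)
    fix z assume z: "z \<in> flow_dom \<tau>" "X + 2 * norm \<tau> < Re (2 / z)"
    then obtain z' where z': "A z' = A z + \<tau>" "norm (2 / z' - 2 / z) \<le> 2 * norm \<tau>"
      using X(2)[of z] norm_ge_zero[of \<tau>] by (smt (verit))
    then have "\<bar>Re (2 / z' - 2 / z)\<bar> \<le> 2 * norm \<tau>"
      using abs_Re_le_cmod order_trans by blast
    then have "2 \<le> Re (2 / z')"
      using z X(1) unfolding minus_complex.sel by linarith
    then have "z' \<in> half_strip" by (intro half_strip_near_0[of 2]) auto
    moreover have "flow \<tau> z \<in> half_strip" "A (flow \<tau> z) = A z'"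
      using flow_props[OF z(1)] sector_subset z'(1) by auto
    ultimately have "flow \<tau> z = z'"
      using A_inj by (auto dest: inj_onD)
    then show "norm (2 / flow \<tau> z - 2 / z) \<le> 2 * norm \<tau>"
      using z' by simp
  qed
qed

text \<open>\<open>A\<close> takes nearly the same value at the truncation \<open>\<phi> z\<close>
  and at \<open>flow \<tau> z\<close>, and being nearly the identity in \<open>2 / z\<close> it
  forces the two points together. Membership of \<open>z\<close> in \<open>sector\<close> turns the
  bound in \<open>Re (2 / z)\<close> into one in \<open>norm z\<close>.\<close>

lemma flow_expansion:
  assumes \<Phi>: "\<Phi> $ 0 = 0" "\<Phi> $ 1 = 1" "\<Phi> $ 2 = - \<tau> / 2" "\<Phi> oo F = F oo \<Phi>"
  obtains K r where "r > 0"
    "\<And>z. z \<in> flow_dom \<tau> \<Longrightarrow> norm z < r \<Longrightarrow>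
       norm (flow \<tau> z - (\<Sum>n\<le>N. \<Phi> $ n * z ^ n)) \<le> K * norm z ^ (N + 1)"
proof -
  define \<phi> where "\<phi> z = (\<Sum>n\<le>N + 4. \<Phi> $ n * z ^ n)" for z
  define P where "P = (\<Sum>n\<le>N + 4. fps_const (\<Phi> $ n) * fps_X ^ n)"
  have P: "P $ k = (if k \<le> N + 4 then \<Phi> $ k else 0)" for k
    unfolding P_def by (rule fps_nth_partial_sum)
  have \<phi>P: "\<phi> has_fps_expansion P"
    unfolding \<phi>_def[abs_def] P_def by (rule partial_sum_has_fps_expansion)
  have tan: "tangent_to_identity \<phi> P"
    by unfold_locales (use \<phi>P P \<Phi> in auto)
  \<comment> \<open>Coefficients of a composition up to order \<open>N + 4\<close> involve only
    coefficients up to that order, so the truncation inherits the commutation.\<close>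
  have comm: "(P oo F) $ k = (F oo P) $ k" if "k < N + 5" for k
  proof -
    have "(P oo F) $ k = (\<Phi> oo F) $ k" "(F oo P) $ k = (F oo \<Phi>) $ k"
      using that by (auto intro!: fps_compose_nth_cong simp: P)
    then show ?thesis using \<Phi>(4) by simp
  qed
  have P2: "P $ 2 = - \<tau> / 2" using P[of 2] \<Phi>(3) by simp
  obtain K X1 where K: "0 \<le> K" "2 \<le> X1"
    "\<And>z. X1 < Re (2 / z) \<Longrightarrow> norm (A (\<phi> z) - A z - \<tau>) \<le> K * (2 / Re (2 / z)) ^ (N + 1)"
    "\<And>z. X1 < Re (2 / z) \<Longrightarrow> norm (2 / \<phi> z - 2 / z) \<le> norm \<tau> + 1"
    by (rule A_increment_of_almost_commuting[OF tan P2 comm]) blast+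
  obtain X2 where X2: "2 \<le> X2"
    "\<And>z. z \<in> flow_dom \<tau> \<Longrightarrow> X2 < Re (2 / z) \<Longrightarrow> norm (2 / flow \<tau> z - 2 / z) \<le> 2 * norm \<tau>"
    by (rule flow_near_0[of \<tau>]) blast
  obtain X3 where X3: "X0 \<le> X3" "\<And>z z'. X3 < Re (2 / z) \<Longrightarrow> X3 < Re (2 / z') \<Longrightarrow>
       norm (A z - A z' - (2 / z - 2 / z')) \<le> 1 / 2 * norm (2 / z - 2 / z')"
    by (rule A_near_identity[of "1 / 2"]) auto
  define X where "X = X1 + X2 + X3 + 2 * norm \<tau> + 1"
  have X: "X1 \<le> X" "X2 \<le> X" "X3 + norm \<tau> + 1 \<le> X" "X3 + 2 * norm \<tau> \<le> X" "0 < X" "2 \<le> X3"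
    using K(2) X2(1) X3(1) X0 norm_ge_zero[of \<tau>] unfolding X_def by linarith+
  have main: "norm (flow \<tau> z - \<phi> z) \<le> K * 2 ^ (N + 1) * norm z ^ (N + 1)"
    if z: "z \<in> flow_dom \<tau>" "norm z < 1 / X" for z
  proof -
    have zs: "z \<in> sector" using z by (simp add: flow_dom_def)
    then have pos: "0 < norm z" by (auto simp: sector_def)
    have "X < 1 / norm z" using z X pos by (simp add: field_simps)
    then have zX: "X < Re (2 / z)"
      using sector_Re_reciprocal[OF zs] by linarith
    define y where "y = \<phi> z"
    define z' where "z' = flow \<tau> z"
    have dy: "norm (2 / y - 2 / z) \<le> norm \<tau> + 1"
      using K(4)[of z] zX X by (simp add: y_def)
    have dz: "norm (2 / z' - 2 / z) \<le> 2 * norm \<tau>"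
      using X2(2)[OF z(1)] zX X by (simp add: z'_def)
    have "\<bar>Re (2 / y - 2 / z)\<bar> \<le> norm \<tau> + 1" "\<bar>Re (2 / z' - 2 / z)\<bar> \<le> 2 * norm \<tau>"
      using dy dz abs_Re_le_cmod order_trans by blast+
    then have Re: "X3 < Re (2 / y)" "X3 < Re (2 / z')"
      using zX X unfolding minus_complex.sel by linarith+
    have nz: "y \<noteq> 0" "z' \<noteq> 0" using Re X by auto
    have small: "norm y \<le> 1" "norm z' \<le> 1"
      using norm_le_Re_reciprocal[of 2 y] norm_le_Re_reciprocal[of 2 z'] Re X by auto
    have "A z' = \<tau> + A z" using flow_props[OF z(1)] by (simp add: z'_def)
    then have Ayz: "norm (A y - A z') \<le> K * (2 / Re (2 / z)) ^ (N + 1)"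
      using K(3)[of z] zX X by (simp add: y_def algebra_simps)
    have "norm (2 / y - 2 / z') \<le> 2 * norm (A y - A z')"
      using X3(2)[OF Re] norm_triangle_sub[of "2 / y - 2 / z'" "A y - A z'"]
      by (simp add: norm_minus_commute)
    also have "\<dots> \<le> 2 * (K * (2 / Re (2 / z)) ^ (N + 1))"
      using Ayz by simp
    also have "\<dots> \<le> 2 * (K * (2 * norm z) ^ (N + 1))"
    proof (intro mult_left_mono power_mono K)
      show "2 / Re (2 / z) \<le> 2 * norm z"
        using sector_Re_reciprocal[OF zs] pos zX X by (simp add: field_simps)
    qed (use zX X in auto)
    finally have d: "norm (2 / y - 2 / z') \<le> 2 * (K * (2 * norm z) ^ (N + 1))" .
    \<comment> \<open>Both \<open>y\<close> and \<open>z'\<close> have norm at most 1, so the bound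
      on the reciprocals carries over to the points.\<close>
    have "z' - y = y * z' * (2 / y - 2 / z') / 2"
      using nz by (simp add: field_simps)
    then have "norm (z' - y) = norm (y * z' * (2 / y - 2 / z') / 2)"
      by (rule arg_cong)
    also have "\<dots> = norm y * norm z' * norm (2 / y - 2 / z') / 2"
      by (simp only: norm_mult norm_divide norm_numeral)
    also have "\<dots> \<le> 1 * 1 * (2 * (K * (2 * norm z) ^ (N + 1))) / 2"
      using small d by (intro divide_right_mono mult_mono) auto
    finally show ?thesis
      by (simp add: y_def z'_def power_mult_distrib mult_ac)
  qed
  \<comment> \<open>The terms of degree \<open>N + 1\<close> to \<open>N + 4\<close> of the
    truncation are absorbed into the error.\<close>
  have "(\<lambda>z. \<phi> z - (\<Sum>n\<le>N. \<Phi> $ n * z ^ n)) has_fps_expansion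
      P - (\<Sum>n\<le>N. fps_const (\<Phi> $ n) * fps_X ^ n)"
    by (intro has_fps_expansion_diff \<phi>P partial_sum_has_fps_expansion)
  moreover have "(P - (\<Sum>n\<le>N. fps_const (\<Phi> $ n) * fps_X ^ n)) $ k = 0" if "k < N + 1" for k
    using that by (simp add: P fps_nth_partial_sum)
  ultimately obtain K' r' where K': "K' > 0" "r' > 0"
    "\<And>z. norm z < r' \<Longrightarrow> norm (\<phi> z - (\<Sum>n\<le>N. \<Phi> $ n * z ^ n)) \<le> K' * norm z ^ (N + 1)"
    by (rule has_fps_expansion_bound) blast+
  show ?thesis
  proof (rule that[of "min (1 / X) r'" "K * 2 ^ (N + 1) + K'"])
    fix z assume z: "z \<in> flow_dom \<tau>" "norm z < min (1 / X) r'"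
    then show "norm (flow \<tau> z - (\<Sum>n\<le>N. \<Phi> $ n * z ^ n)) \<le> (K * 2 ^ (N + 1) + K') * norm z ^ (N + 1)"
      using main[of z] K'(3)[of z]
        norm_triangle_ineq[of "flow \<tau> z - \<phi> z" "\<phi> z - (\<Sum>n\<le>N. \<Phi> $ n * z ^ n)"]
      by (simp add: distrib_right)
  qed (use X K' in auto)
qed

section \<open>Increments of the Abel function from second-order data\<close>

lemma orbit_tendsto_0:
  assumes "z \<in> half_strip"
  shows "(\<lambda>n. (f ^^ n) z) \<longlonglongrightarrow> 0"
proof -
  have "filterlim (\<lambda>n. norm (2 / (f ^^ n) z)) at_top sequentially"
    by (rule norm_at_top_if_Re[OF iter_Re_at_top[OF assms]])
  from tendsto_mult_right_zero[OF tendsto_inverse_0_at_top[OF this], of 2]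
  have "(\<lambda>n. norm ((f ^^ n) z)) \<longlonglongrightarrow> 0"
    by (simp add: norm_divide)
  then show ?thesis by (simp add: tendsto_norm_zero_iff)
qed

text \<open>Since \<open>2 / Y - 2 / X = - 2 (Y - X) / (X Y)\<close> and \<open>Y / X\<close> tends
  to 1, the hypothesis makes the difference in the coordinate \<open>2 / z\<close> tend to
  \<open>\<tau>\<close>. The increment of \<open>A\<close> is constant along the pair of orbits, so
  the limit is its value.\<close>

lemma A_diff_of_orbit_expansion:
  assumes x: "x \<in> half_strip" and y: "y \<in> half_strip"
    and lim: "(\<lambda>n. ((f ^^ n) y - (f ^^ n) x) / ((f ^^ n) x)\<^sup>2) \<longlonglongrightarrow> - \<tau> / 2"
  shows "A y - A x = \<tau>"
proof -
  define X where "X n = (f ^^ n) x" for n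
  define Y where "Y n = (f ^^ n) y" for n
  define q where "q n = (Y n - X n) / (X n)\<^sup>2" for n
  have nz: "X n \<noteq> 0" "Y n \<noteq> 0" for n
    using half_strip_nonzero[OF half_strip_iter[OF x]] half_strip_nonzero[OF half_strip_iter[OF y]]
    by (auto simp: X_def Y_def)
  have q: "q \<longlonglongrightarrow> - \<tau> / 2" using lim unfolding q_def[abs_def] X_def Y_def .
  have X_lim: "X \<longlonglongrightarrow> 0"
    unfolding X_def[abs_def] by (rule orbit_tendsto_0[OF x])
  have "(\<lambda>n. - 2 * q n / (1 + X n * q n)) \<longlonglongrightarrow> - 2 * (- \<tau> / 2) / (1 + 0 * (- \<tau> / 2))"
    using q X_lim by (intro tendsto_intros) auto
  moreover have "- 2 * q n / (1 + X n * q n) = 2 / Y n - 2 / X n" for n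
  proof -
    have "1 + X n * q n = Y n / X n"
      using nz[of n] by (simp add: q_def power2_eq_square field_simps)
    then show ?thesis
      using nz[of n] by (simp add: q_def power2_eq_square field_simps)
  qed
  ultimately have "(\<lambda>n. 2 / Y n - 2 / X n) \<longlonglongrightarrow> \<tau>"
    by simp
  then have "(\<lambda>n. A (Y n) - A (X n)) \<longlonglongrightarrow> \<tau>"
    using iter_Re_at_top[OF x] by (intro A_diff_tendsto) (auto simp: X_def)
  moreover have "A (Y n) - A (X n) = A y - A x" for n
    using A_iter[OF x, of n] A_iter[OF y, of n] by (simp add: X_def Y_def)
  ultimately show ?thesis
    by (simp add: LIMSEQ_const_iff)
qed

end

section \<open>Transfer from the germ to the given map\<close>

lemma formal_regular_iterate_iff:
  assumes H: "H $ 0 = 0" "H $ 1 = 1" "H $ 2 \<noteq> 0"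
  shows "formal_regular_iterate H t \<Phi> \<longleftrightarrow>
    \<Phi> $ 0 = 0 \<and> \<Phi> $ 1 = 1 \<and> \<Phi> $ 2 = t * H $ 2 \<and> \<Phi> oo H = H oo \<Phi>"
proof -
  have "subdegree (H - fps_X) = 2"
    using H by (intro subdegreeI) (auto simp: less_2_cases_iff fps_X_nth)
  then show ?thesis
    unfolding formal_regular_iterate_def Let_def by (auto simp: numeral_2_eq_2 less_Suc_eq)
qed

text \<open>With \<open>c = -1\<close> the attracting petal of \<open>f\<close> is that of \<open>g\<close>, reflected at the origin; with
  \<open>c = 1\<close> it is the repelling petal of \<open>g\<close>, and \<open>f\<close> is the inverse of \<open>g\<close> there.\<close>

locale petal = parabolic_germ f F for f F +
  fixes g :: "complex \<Rightarrow> complex" and c :: complex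
  assumes c: "c = 1 \<or> c = - 1"
    and g_fps: "fps_expansion g 0 $ 0 = 0" "fps_expansion g 0 $ 1 = 1" "fps_expansion g 0 $ 2 = 1 / 2"
    and commute: "\<Phi> $ 0 = 0 \<Longrightarrow> \<Phi> oo F = F oo \<Phi> \<Longrightarrow>
      Abs_fps (\<lambda>n. c ^ Suc n * \<Phi> $ n) oo fps_expansion g 0 =
      fps_expansion g 0 oo Abs_fps (\<lambda>n. c ^ Suc n * \<Phi> $ n)"
    and abel: "c * z \<in> sector \<Longrightarrow> c * g z \<in> sector \<Longrightarrow> A (c * g z) = A (c * z) - c"
begin

lemma c2 [simp]: "c * c = 1" "c * (c * z) = z" "c \<noteq> 0" "norm c = 1"
  using c by auto

lemma g_formal_iff:
  "formal_regular_iterate (fps_expansion g 0) t \<Phi> \<longleftrightarrow>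
    \<Phi> $ 0 = 0 \<and> \<Phi> $ 1 = 1 \<and> \<Phi> $ 2 = t / 2 \<and> \<Phi> oo fps_expansion g 0 = fps_expansion g 0 oo \<Phi>"
  using formal_regular_iterate_iff[of "fps_expansion g 0" t \<Phi>] g_fps by simp

definition D :: "complex set" where "D = {z. c * z \<in> sector}"
text \<open>For \<open>c = - 1\<close>, \<open>g\<close> is conjugate to \<open>f\<close>, and
  \<open>A (- z)\<close> gains 1 under \<open>g\<close>. For \<open>c = 1\<close>, \<open>g\<close>
  inverts \<open>f\<close>, so \<open>A\<close> loses 1 and its sign is reversed.\<close>

definition \<alpha> :: "complex \<Rightarrow> complex" where "\<alpha> z = - c * A (c * z)"

lemma D_eq_image: "D = (*) c ` sector"
proof
  show "D \<subseteq> (*) c ` sector"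
  proof
    fix z assume "z \<in> D"
    then show "z \<in> (*) c ` sector"
      by (intro image_eqI[of _ _ "c * z"]) (auto simp: D_def)
  qed
qed (auto simp: D_def)

lemma open_D: "open D"
proof -
  have "D = (*) c -` sector" by (auto simp: D_def)
  moreover have "open ((*) c -` sector)"
    by (intro open_vimage open_sector continuous_intros)
  ultimately show ?thesis by simp
qed

lemma connected_D: "connected D"
  unfolding D_eq_image
  by (intro connected_continuous_image convex_connected convex_sector continuous_intros)

lemma \<alpha>_holo: "\<alpha> holomorphic_on D"
proof -
  have "(A \<circ> (*) c) holomorphic_on D"
    using sector_subset
    by (intro holomorphic_on_compose holomorphic_intros holomorphic_on_subset[OF A_holo]) (auto simp: D_def)
  then show ?thesis
    unfolding \<alpha>_def[abs_def] by (auto intro!: holomorphic_intros simp: o_def)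
qed

lemma \<alpha>_inj: "inj_on \<alpha> D"
proof (rule inj_onI)
  fix z z' assume *: "z \<in> D" "z' \<in> D" "\<alpha> z = \<alpha> z'"
  then have "c * z = c * z'"
    using A_inj_sector by (auto simp: D_def \<alpha>_def dest: inj_onD)
  then show "z = z'" by simp
qed

lemma \<alpha>_eq_iff: "\<alpha> y = t + \<alpha> z \<longleftrightarrow> A (c * y) = - c * t + A (c * z)"
proof -
  have "\<alpha> y = t + \<alpha> z \<longleftrightarrow> - c * \<alpha> y = - c * (t + \<alpha> z)" by simp
  also have "\<dots> \<longleftrightarrow> A (c * y) = - c * t + A (c * z)"
    by (simp add: \<alpha>_def algebra_simps flip: mult.assoc)
  finally show ?thesis .
qed

text \<open>Time \<open>t\<close> of \<open>g\<close> is time \<open>- c * t\<close> of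
  \<open>f\<close>, conjugated by multiplication with \<open>c\<close>; time runs backwards when
  \<open>g\<close> inverts \<open>f\<close>.\<close>

lemma flow_conjugate:
  "{z \<in> D. t + \<alpha> z \<in> \<alpha> ` D} = {z. c * z \<in> flow_dom (- c * t)}" (is "?S = ?S'")
  "z \<in> {z \<in> D. t + \<alpha> z \<in> \<alpha> ` D} \<Longrightarrow> inv_into D \<alpha> (t + \<alpha> z) = c * flow (- c * t) (c * z)"
proof -
  have "t + \<alpha> z \<in> \<alpha> ` D \<longleftrightarrow> - c * t + A (c * z) \<in> A ` sector" for z
  proof
    assume "t + \<alpha> z \<in> \<alpha> ` D"
    then obtain y where "y \<in> D" "\<alpha> y = t + \<alpha> z" by force
    then show "- c * t + A (c * z) \<in> A ` sector"
      by (intro image_eqI[of _ _ "c * y"]) (auto simp: \<alpha>_eq_iff D_def)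
  next
    assume "- c * t + A (c * z) \<in> A ` sector"
    then obtain y where "y \<in> sector" "A y = - c * t + A (c * z)" by force
    then show "t + \<alpha> z \<in> \<alpha> ` D"
      using \<alpha>_eq_iff[of "c * y" t z] by (intro image_eqI[of _ _ "c * y"]) (auto simp: D_def)
  qed
  then show S: "?S = ?S'"
    by (auto simp: flow_dom_def D_def)
  assume "z \<in> ?S"
  then have z: "c * z \<in> flow_dom (- c * t)" using S by blast
  have "\<alpha> (c * flow (- c * t) (c * z)) = t + \<alpha> z"
    unfolding \<alpha>_eq_iff using flow_props[OF z] by simp
  moreover have "c * flow (- c * t) (c * z) \<in> D"
    using flow_props[OF z] by (simp add: D_def)
  ultimately show "inv_into D \<alpha> (t + \<alpha> z) = c * flow (- c * t) (c * z)"
    using \<alpha>_inj inv_into_f_f by metis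
qed

lemma regular_iteration_\<alpha>:
  "regular_iteration g t (\<lambda>z. inv_into D \<alpha> (t + \<alpha> z)) {z \<in> D. t + \<alpha> z \<in> \<alpha> ` D}"
    (is "regular_iteration g t ?f ?S")
  unfolding regular_iteration_def
proof (intro conjI)
  have "continuous_on D (\<lambda>z. t + \<alpha> z)"
    using \<alpha>_holo by (intro continuous_intros holomorphic_on_imp_continuous_on)
  moreover have "open (\<alpha> ` D)"
    using \<alpha>_holo open_D \<alpha>_inj by (rule open_mapping_thm3)
  ultimately have "open (D \<inter> (\<lambda>z. t + \<alpha> z) -` (\<alpha> ` D))"
    using open_D by (intro continuous_open_preimage)
  then show "open ?S" by (simp add: vimage_def Int_def)
  show "0 islimpt ?S"
    unfolding flow_conjugate(1) islimpt_approachable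
  proof (intro allI impI)
    fix e :: real assume "e > 0"
    then obtain x where "x \<in> flow_dom (- c * t)" "x \<noteq> 0" "dist x 0 < e"
      using flow_dom_limpt[of "- c * t"] unfolding islimpt_approachable by blast
    then show "\<exists>x'\<in>{z. c * z \<in> flow_dom (- c * t)}. x' \<noteq> 0 \<and> dist x' 0 < e"
      by (intro bexI[of _ "c * x"]) (auto simp: norm_mult)
  qed
  obtain \<sigma> where \<sigma>: "\<sigma> holomorphic_on \<alpha> ` D" "\<And>z. z \<in> D \<Longrightarrow> \<sigma> (\<alpha> z) = z"
    using holomorphic_has_inverse[OF \<alpha>_holo open_D \<alpha>_inj] by metis
  have "(\<sigma> \<circ> (\<lambda>z. t + \<alpha> z)) holomorphic_on ?S"
    using \<alpha>_holo
    by (intro holomorphic_on_compose holomorphic_intros)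
      (auto elim: holomorphic_on_subset intro: holomorphic_on_subset[OF \<sigma>(1)])
  then show "?f holomorphic_on ?S"
    by (rule holomorphic_transform) (use \<sigma>(2) \<alpha>_inj in auto)
  have "F $ 2 \<noteq> 0" using F2 by simp
  then obtain \<Phi> where \<Phi>: "\<Phi> $ 0 = 0" "\<Phi> $ 1 = 1" "\<Phi> $ 2 = - c * t * F $ 2" "\<Phi> oo F = F oo \<Phi>"
    using formal_iterate_exists[OF F0 F1] by blast
  \<comment> \<open>This is \<open>c * \<Phi>(c X)\<close> in coefficients. Its second coefficient
    is \<open>c^3 * (c * t / 2) = t / 2\<close>.\<close>
  define \<Psi> where "\<Psi> = Abs_fps (\<lambda>n. c ^ Suc n * \<Phi> $ n)"
  have "formal_regular_iterate (fps_expansion g 0) t \<Psi>"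
    unfolding g_formal_iff
  proof (intro conjI)
    show "\<Psi> $ 2 = t / 2" using \<Phi>(3) F2 c by (auto simp: \<Psi>_def)
  qed (use \<Phi> commute[OF \<Phi>(1,4)] in \<open>auto simp: \<Psi>_def\<close>)
  moreover have "has_asymp_expansion ?f \<Psi> ?S"
    unfolding has_asymp_expansion_def
  proof
    fix N
    obtain K r where K: "r > 0"
      "\<And>z. z \<in> flow_dom (- c * t) \<Longrightarrow> norm z < r \<Longrightarrow>
       norm (flow (- c * t) z - (\<Sum>n\<le>N. \<Phi> $ n * z ^ n)) \<le> K * norm z ^ (N + 1)"
      by (rule flow_expansion[of \<Phi> "- c * t" N]) (use \<Phi> F2 in auto)
    show "(\<lambda>z. ?f z - (\<Sum>n\<le>N. \<Psi> $ n * z ^ n)) \<in> o[at 0 within ?S](\<lambda>z. z ^ N)"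
    proof (rule smallo_power_if_bound[OF K(1)])
      fix z assume z: "z \<in> ?S" "norm z < r"
      have "(\<Sum>n\<le>N. \<Psi> $ n * z ^ n) = c * (\<Sum>n\<le>N. \<Phi> $ n * (c * z) ^ n)"
        by (simp add: \<Psi>_def sum_distrib_left power_mult_distrib mult_ac)
      then have "?f z - (\<Sum>n\<le>N. \<Psi> $ n * z ^ n) =
          c * (flow (- c * t) (c * z) - (\<Sum>n\<le>N. \<Phi> $ n * (c * z) ^ n))"
        using flow_conjugate(2)[OF z(1)] by (simp add: algebra_simps)
      moreover have "c * z \<in> flow_dom (- c * t)"
        using z(1) unfolding flow_conjugate(1) by simp
      ultimately show "norm (?f z - (\<Sum>n\<le>N. \<Psi> $ n * z ^ n)) \<le> K * norm z ^ (N + 1)"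
        using K(2)[of "c * z"] z(2) by (simp add: norm_mult)
    qed
  qed
  ultimately show "\<exists>F. formal_regular_iterate (fps_expansion g 0) t F \<and> has_asymp_expansion ?f F ?S"
    by blast
qed

lemma regular_abel_\<alpha>: "regular_abel_function g D \<alpha>"
  unfolding regular_abel_function_def Let_def
proof (intro conjI ballI impI allI regular_iteration_\<alpha> open_D connected_D \<alpha>_holo \<alpha>_inj)
  fix z assume "z \<in> D" "g z \<in> D"
  then have "A (c * g z) = A (c * z) - c"
    by (intro abel) (auto simp: D_def)
  then have "c * A (c * g z) = c * (A (c * z) - c)" by simp
  then show "\<alpha> (g z) = \<alpha> z + 1"
    by (simp add: \<alpha>_def right_diff_distrib)
qed

text \<open>At the orbit of \<open>p\<close> the regular iteration
  \<open>\<sigma> (t + \<beta> z)\<close> takes the values of the orbit of \<open>q\<close>. Its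
  expansion has second coefficient \<open>t / 2\<close>, and this coefficient already determines the
  increment of \<open>A\<close>.\<close>

lemma regular_abel_increment:
  assumes reg: "regular_abel_function g E \<beta>"
    and p: "c * p \<in> half_strip" and q: "c * q \<in> half_strip"
    and orb: "\<And>n. c * (f ^^ n) (c * p) \<in> E" "\<And>n. c * (f ^^ n) (c * q) \<in> E"
      "\<And>n. \<beta> (c * (f ^^ n) (c * q)) = t + \<beta> (c * (f ^^ n) (c * p))"
  shows "\<alpha> q - \<alpha> p = t"
proof -
  define P where "P n = c * (f ^^ n) (c * p)" for n
  define Q where "Q n = c * (f ^^ n) (c * q)" for n
  define S where "S = {z \<in> E. t + \<beta> z \<in> \<beta> ` E}"
  have inj: "inj_on \<beta> E"
    using reg by (simp add: regular_abel_function_def)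
  obtain \<Phi> where \<Phi>: "formal_regular_iterate (fps_expansion g 0) t \<Phi>"
      "has_asymp_expansion (\<lambda>z. inv_into E \<beta> (t + \<beta> z)) \<Phi> S"
    using reg unfolding regular_abel_function_def Let_def regular_iteration_def S_def by blast
  have PS: "P n \<in> S" and Q: "inv_into E \<beta> (t + \<beta> (P n)) = Q n" for n
  proof -
    have "\<beta> (Q n) = t + \<beta> (P n)" "Q n \<in> E" "P n \<in> E"
      using orb by (auto simp: P_def Q_def)
    then show "P n \<in> S" "inv_into E \<beta> (t + \<beta> (P n)) = Q n"
      using inj by (auto simp: S_def intro: inv_into_f_eq rev_image_eqI)
  qed
  have P0: "P n \<noteq> 0" for n
    using half_strip_nonzero[OF half_strip_iter[OF p]] by (simp add: P_def)
  have "P \<longlonglongrightarrow> 0"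
    unfolding P_def[abs_def] using tendsto_mult_right_zero[OF orbit_tendsto_0[OF p]] by simp
  then have lim: "filterlim P (at 0 within S) sequentially"
    using PS P0 by (simp add: filterlim_at)
  have "(\<lambda>z. inv_into E \<beta> (t + \<beta> z) - (\<Sum>n\<le>2. \<Phi> $ n * z ^ n)) \<in> o[at 0 within S](\<lambda>z. z ^ 2)"
    using \<Phi>(2) by (simp add: has_asymp_expansion_def)
  then have "((\<lambda>z. (inv_into E \<beta> (t + \<beta> z) - (\<Sum>n\<le>2. \<Phi> $ n * z ^ n)) / z ^ 2) \<longlongrightarrow> 0) (at 0 within S)"
    by (rule smalloD_tendsto)
  from filterlim_compose[OF this lim]
  have "(\<lambda>n. (Q n - (\<Sum>k\<le>2. \<Phi> $ k * P n ^ k)) / P n ^ 2) \<longlonglongrightarrow> 0"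
    by (simp add: Q)
  moreover have "(Q n - (\<Sum>k\<le>2. \<Phi> $ k * P n ^ k)) / P n ^ 2 = (Q n - P n) / P n ^ 2 - t / 2" for n
    using \<Phi>(1) P0[of n] unfolding g_formal_iff by (simp add: numeral_2_eq_2 field_simps)
  ultimately have "(\<lambda>n. (Q n - P n) / P n ^ 2) \<longlonglongrightarrow> t / 2"
    by (simp add: LIM_zero_iff)
  then have "(\<lambda>n. c * ((Q n - P n) / P n ^ 2)) \<longlonglongrightarrow> c * (t / 2)"
    by (rule tendsto_mult_left)
  moreover have "c * ((Q n - P n) / P n ^ 2) =
      ((f ^^ n) (c * q) - (f ^^ n) (c * p)) / ((f ^^ n) (c * p))\<^sup>2" for n
    by (simp add: P_def Q_def power_mult_distrib power2_eq_square[of c] algebra_simps)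
  ultimately have "A (c * q) - A (c * p) = - c * t"
    by (intro A_diff_of_orbit_expansion p q) simp
  then have "c * (A (c * q) - A (c * p)) = c * (- c * t)"
    by simp
  then show ?thesis
    by (simp add: \<alpha>_def algebra_simps)
qed

end

subsection \<open>The exponential and the logarithm\<close>

lemma h_fps_expansion: "fps_expansion (h :: complex \<Rightarrow> complex) 0 = fps_exp 1 - 1"
proof -
  have "h has_fps_expansion (fps_exp (1::complex) - 1)"
    unfolding h_def[abs_def] by (intro has_fps_expansion_diff has_fps_expansion_exp1 has_fps_expansion_1)
  moreover from this have "h has_fps_expansion fps_expansion (h :: complex \<Rightarrow> complex) 0"
    by (intro analytic_at_imp_has_fps_expansion_0 has_fps_expansion_imp_analytic_0)
  ultimately show ?thesis
    using fps_expansion_unique_complex by blast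
qed

lemma h_of_real: "h (of_real x) = (of_real (h x) :: complex)"
  by (simp add: h_def exp_of_real)

text \<open>For \<open>z = \<i> y\<close> the squared norm of \<open>1 - exp (- z)\<close> is
  \<open>2 (1 - cos y)\<close>, so this is the strict decrease on the imaginary axis. The half-angle
  formula reduces it to \<open>|sin (y/2)| < |y/2|\<close>.\<close>

lemma one_minus_cos_less: "1 - cos y < y\<^sup>2 / 2" if "y \<noteq> 0" for y :: real
proof -
  have less: "sin x < x" if "0 < x" for x :: real
  proof (cases "x < pi")
    case True
    have "\<exists>z. 0 < z \<and> z < x \<and> (x - sin x) - (0 - sin 0) = (x - 0) * (1 - cos z)"
      by (rule MVT2) (auto intro!: derivative_eq_intros simp: that)
    then obtain z where z: "0 < z" "z < x" "x - sin x = x * (1 - cos z)" by auto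
    have "cos z < cos 0"
      using z True by (intro cos_monotone_0_pi) auto
    then have "0 < x * (1 - cos z)" using that by simp
    then show ?thesis using z by simp
  next
    case False
    then show ?thesis
      using sin_le_one[of x] pi_gt3 by linarith
  qed
  have "\<bar>sin (y / 2)\<bar> < \<bar>y / 2\<bar>"
  proof (cases "\<bar>y\<bar> / 2 < pi")
    case True
    have "0 < \<bar>y\<bar> / 2" using that by simp
    moreover have "\<bar>sin (y / 2)\<bar> = sin (\<bar>y\<bar> / 2)"
      using sin_gt_zero[of "\<bar>y\<bar> / 2"] that True by (cases "0 < y") auto
    ultimately show ?thesis using less[of "\<bar>y\<bar> / 2"] by simp
  next
    case False
    then show ?thesis
      using abs_sin_le_one[of "y / 2"] pi_gt3 by linarith
  qed
  then have "\<bar>sin (y / 2)\<bar>\<^sup>2 < \<bar>y / 2\<bar>\<^sup>2"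
    by (rule power_strict_mono) auto
  then have "(sin (y / 2))\<^sup>2 < (y / 2)\<^sup>2"
    by (simp only: power2_abs)
  moreover have "1 - cos y = 2 * (sin (y / 2))\<^sup>2"
    using cos_double_sin[of "y / 2"] by simp
  ultimately show ?thesis by (simp add: power_divide)
qed

text \<open>With \<open>t = exp (- x)\<close> the squared norm splits as
  \<open>(1 - t)^2 + 2 t (1 - cos y)\<close>, and the two terms are compared with \<open>x^2\<close>
  and \<open>y^2\<close>. Which comparison is strict depends on whether \<open>y\<close>
  vanishes.\<close>

lemma norm_one_minus_exp_less:
  assumes "0 \<le> Re z" "z \<noteq> 0"
  shows "norm (1 - exp (- z)) < norm z"
proof -
  define x where "x = Re z"
  define y where "y = Im z"
  define t where "t = exp (- x)"
  have x: "0 \<le> x" using assms by (simp add: x_def)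
  have t: "0 < t" "t \<le> 1" "1 - t \<le> x"
    using x exp_ge_add_one_self[of "- x"] by (auto simp: t_def)
  have "(norm (1 - exp (- z)))\<^sup>2 = (1 - t * cos y)\<^sup>2 + (t * sin y)\<^sup>2"
    by (simp add: cmod_power2 Re_exp Im_exp x_def y_def t_def)
  also have "\<dots> = (1 - t)\<^sup>2 + 2 * t * (1 - cos y)"
  proof -
    have "(1 - t * cos y)\<^sup>2 + (t * sin y)\<^sup>2 = 1 - 2 * t * cos y + t\<^sup>2 * ((cos y)\<^sup>2 + (sin y)\<^sup>2)"
      by algebra
    then show ?thesis
      unfolding sin_cos_squared_add2 by (simp add: power2_eq_square algebra_simps)
  qed
  also have "\<dots> < x\<^sup>2 + y\<^sup>2"
  proof (cases "y = 0")
    case True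
    then have "0 < x" using assms x by (auto simp: x_def y_def complex_eq_iff)
    then have "1 - t < x"
      using exp_minus_greater[of x] exp_ge_add_one_self[of "-x"] by (auto simp: t_def)
    then have "(1 - t)\<^sup>2 < x\<^sup>2" using t by (intro power_strict_mono) auto
    then show ?thesis using True by simp
  next
    case False
    have "2 * t * (1 - cos y) < 2 * t * (y\<^sup>2 / 2)"
      using one_minus_cos_less[OF False] t by (intro mult_strict_left_mono) auto
    also have "\<dots> \<le> y\<^sup>2" using t by (simp add: mult_left_le_one_le)
    finally have "2 * t * (1 - cos y) < y\<^sup>2" .
    moreover have "(1 - t)\<^sup>2 \<le> x\<^sup>2" using t by (intro power_mono) auto
    ultimately show ?thesis by simp
  qed
  also have "\<dots> = (norm z)\<^sup>2" by (simp add: cmod_power2 x_def y_def)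
  finally show ?thesis by (rule power2_less_imp_less) simp
qed

text \<open>The derivative \<open>1 / (1 + w)\<close> is bounded by 1 on the half-plane, which alone
  gives only a weak inequality. On the outer half of the segment from 0 to \<open>z\<close> the
  squared norm of \<open>1 + w\<close> is at least \<open>1 + (norm z / 2)^2\<close>, so there the
  bound is a constant \<open>B < 1\<close>.\<close>

lemma norm_Ln_one_plus_less:
  assumes z: "0 \<le> Re z" "z \<noteq> 0"
  shows "norm (Ln (1 + z)) < norm z"
proof -
  have deriv: "((\<lambda>w. Ln (1 + w)) has_field_derivative 1 / (1 + w)) (at w within S)"
    if "0 \<le> Re w" for w S
  proof -
    have "1 + w \<notin> \<real>\<^sub>\<le>\<^sub>0" using that by (auto simp: complex_nonpos_Reals_iff)
    then show ?thesis by (auto intro!: derivative_eq_intros simp: divide_inverse)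
  qed
  have 1: "norm (Ln (1 + z / 2) - Ln (1 + 0)) \<le> 1 * norm (z / 2 - 0)"
  proof (rule field_differentiable_bound[where f' = "\<lambda>w. 1 / (1 + w)"])
    show "convex {w. 0 \<le> Re w}" by (rule convex_halfspace_Re_ge)
    fix w :: complex assume "w \<in> {w. 0 \<le> Re w}"
    then show "((\<lambda>w. Ln (1 + w)) has_field_derivative 1 / (1 + w)) (at w within {w. 0 \<le> Re w})"
      and "norm (1 / (1 + w)) \<le> 1"
      using deriv complex_Re_le_cmod[of "1 + w"] by (auto simp: norm_divide divide_le_eq_1)
  qed (use z in auto)
  define B where "B = 1 / sqrt (1 + (norm z / 2)\<^sup>2)"
  have 2: "norm (Ln (1 + z) - Ln (1 + z / 2)) \<le> B * norm (z - z / 2)"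
  proof (rule field_differentiable_bound[where f' = "\<lambda>w. 1 / (1 + w)"])
    show "convex (closed_segment (z / 2) z)" by simp
    fix w :: complex assume "w \<in> closed_segment (z / 2) z"
    then obtain u where u: "0 \<le> u" "u \<le> 1" "w = (1 - u) *\<^sub>R (z / 2) + u *\<^sub>R z"
      by (auto simp: closed_segment_def)
    then have w: "w = of_real ((1 + u) / 2) * z"
      by (simp add: scaleR_conv_of_real field_simps)
    have Re: "0 \<le> Re w" using u z by (simp add: w)
    then show "((\<lambda>w. Ln (1 + w)) has_field_derivative 1 / (1 + w)) (at w within closed_segment (z / 2) z)"
      by (rule deriv)
    have "norm w = (1 + u) / 2 * norm z"
      unfolding w norm_mult norm_of_real using u(1) by simp
    moreover have "1 / 2 * norm z \<le> (1 + u) / 2 * norm z"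
      using u(1) by (intro mult_right_mono) auto
    ultimately have "norm z / 2 \<le> norm w" by simp
    then have "(norm z / 2)\<^sup>2 \<le> (norm w)\<^sup>2" by (intro power_mono) auto
    moreover have norm_sq: "(norm (1 + w))\<^sup>2 = 1 + 2 * Re w + (norm w)\<^sup>2"
      unfolding cmod_power2 by (simp add: power2_eq_square algebra_simps)
    ultimately have "1 + (norm z / 2)\<^sup>2 \<le> (norm (1 + w))\<^sup>2"
      using Re norm_sq by linarith
    then have "sqrt (1 + (norm z / 2)\<^sup>2) \<le> norm (1 + w)"
      by (simp add: real_le_lsqrt)
    moreover have "0 < sqrt (1 + (norm z / 2)\<^sup>2)"
      by (simp add: add_pos_nonneg)
    ultimately show "norm (1 / (1 + w)) \<le> B"
      unfolding B_def norm_divide norm_one by (intro divide_left_mono mult_pos_pos) linarith+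
  qed auto
  have "0 < (norm z / 2)\<^sup>2" using z by simp
  then have "1 < sqrt (1 + (norm z / 2)\<^sup>2)" by (intro real_less_rsqrt) simp
  then have "B < 1"
    unfolding B_def by (subst divide_less_eq_1_pos) linarith+
  moreover have "0 < norm (z / 2)" using z by simp
  ultimately have "B * norm (z / 2) < norm (z / 2)" by simp
  moreover have "norm (Ln (1 + z)) \<le> norm (Ln (1 + z) - Ln (1 + z / 2)) + norm (Ln (1 + z / 2))"
    using norm_triangle_ineq[of "Ln (1 + z) - Ln (1 + z / 2)" "Ln (1 + z / 2)"] by simp
  moreover have "z - z / 2 = z / 2" by simp
  ultimately show ?thesis
    using 1 2 by (simp add: norm_divide)
qed

text \<open>The series is \<open>X - X^2/2 + X^3/6 - ...\<close>, so
  \<open>b = 1 - 4/6 = 1/3\<close>.\<close>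

interpretation attracting: parabolic_germ "\<lambda>z. 1 - exp (- z)" "1 - fps_exp (- 1)"
proof
  show "(\<lambda>z::complex. 1 - exp (- z)) has_fps_expansion 1 - fps_exp (- 1)"
    by (intro has_fps_expansion_diff has_fps_expansion_exp_neg1 has_fps_expansion_1)
  show "(1 - fps_exp (- 1 :: complex)) $ 2 = - 1 / 2"
    by (simp add: numeral_2_eq_2)
  show "continuous_on {z. 0 \<le> Re z} (\<lambda>z::complex. 1 - exp (- z))"
    by (intro continuous_intros)
  show "(\<lambda>z. 1 - exp (- z)) holomorphic_on half_strip"
    by (intro holomorphic_intros)
  show "1 - exp (- z) \<in> half_strip" if "z \<in> half_strip" for z :: complex
  proof -
    have "norm (exp (- z)) < 1" using that by (simp add: half_strip_def)
    then have "\<bar>Re (exp (- z))\<bar> < 1" "\<bar>Im (exp (- z))\<bar> < 1"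
      using abs_Re_le_cmod[of "exp (- z)"] abs_Im_le_cmod[of "exp (- z)"] by linarith+
    then show ?thesis
      using pi_gt3 unfolding half_strip_def mem_Collect_eq minus_complex.sel one_complex.sel by linarith
  qed
  show "inj_on (\<lambda>z. 1 - exp (- z)) half_strip"
  proof (rule inj_onI)
    fix z w :: complex assume *: "z \<in> half_strip" "w \<in> half_strip" "1 - exp (- z) = 1 - exp (- w)"
    have "Ln (exp (- v)) = - v" if "v \<in> half_strip" for v
      using that by (intro Ln_exp) (auto simp: half_strip_def)
    then show "z = w" using * by (metis diff_left_imp_eq minus_minus diff_eq_eq add_diff_cancel_left')
  qed
qed (auto simp: norm_one_minus_exp_less)

definition Ln_series :: "complex fps" where
  "Ln_series = fps_expansion (\<lambda>z. Ln (1 + z)) 0"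

lemma Ln_series: "(\<lambda>z. Ln (1 + z)) has_fps_expansion Ln_series"
proof -
  have "(\<lambda>z. Ln (1 + z)) analytic_on {0}"
    by (intro analytic_intros) auto
  then show ?thesis
    unfolding Ln_series_def by (rule analytic_at_imp_has_fps_expansion_0)
qed

lemma Ln_series_0: "Ln_series $ 0 = 0"
  using has_fps_expansion_imp_0_eq_fps_nth_0[OF Ln_series] by simp

lemma exp_Ln_series: "(fps_exp 1 - 1) oo Ln_series = fps_X"
proof -
  have "((\<lambda>z. exp z - 1) \<circ> (\<lambda>z. Ln (1 + z))) has_fps_expansion ((fps_exp 1 - 1) oo Ln_series)"
    using Ln_series_0
    by (intro has_fps_expansion_compose has_fps_expansion_diff has_fps_expansion_exp1
        has_fps_expansion_1 Ln_series)
  moreover have ev: "eventually (\<lambda>z. ((\<lambda>z. exp z - 1) \<circ> (\<lambda>z. Ln (1 + z))) z = z) (nhds (0::complex))"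
  proof -
    have "eventually (\<lambda>z. z \<in> ball 0 1) (nhds (0::complex))"
      by (intro eventually_nhds_in_open) auto
    then show ?thesis
    proof eventually_elim
      case (elim z)
      then have "1 + z \<noteq> 0" by (auto simp: add_eq_0_iff)
      then show ?case by simp
    qed
  qed
  ultimately have "(\<lambda>z. z) has_fps_expansion ((fps_exp 1 - 1) oo Ln_series)"
    using has_fps_expansion_cong[OF ev refl] by blast
  then show ?thesis
    using has_fps_expansion_fps_X fps_expansion_unique_complex by blast
qed

text \<open>Both series are the compositional inverse of \<open>fps_exp 1 - 1\<close>; the
  identification provides explicit coefficients.\<close>

lemma Ln_series_eq: "Ln_series = fps_ln 1"
proof -
  have E: "(fps_exp 1 - 1 :: complex fps) $ 0 = 0" "(fps_exp 1 - 1 :: complex fps) $ 1 \<noteq> 0"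
    by auto
  have "fps_inv (fps_exp 1 - 1) oo ((fps_exp 1 - 1) oo Ln_series) = Ln_series"
    using fps_inv[OF E] E Ln_series_0 by (subst fps_compose_assoc) auto
  then have "Ln_series = fps_inv (fps_exp 1 - 1)"
    by (simp add: exp_Ln_series)
  then show ?thesis by (simp add: fps_ln_fps_exp_inv)
qed

text \<open>The third coefficient is \<open>1/3\<close>, so
  \<open>b = 1 - 4/3 = - 1/3\<close>.\<close>

interpretation repelling: parabolic_germ "\<lambda>z. Ln (1 + z)" "Ln_series"
proof
  have pos: "1 + z \<notin> \<real>\<^sub>\<le>\<^sub>0" if "0 \<le> Re z" for z
    using that by (auto simp: complex_nonpos_Reals_iff)
  show "(\<lambda>z. Ln (1 + z)) has_fps_expansion Ln_series" by (rule Ln_series)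
  show "Ln_series $ 0 = 0" "Ln_series $ 1 = 1" "Ln_series $ 2 = - 1 / 2"
    by (auto simp: Ln_series_eq fps_ln_nth)
  show "continuous_on {z. 0 \<le> Re z} (\<lambda>z. Ln (1 + z))"
    using pos by (intro continuous_intros) auto
  show "(\<lambda>z. Ln (1 + z)) holomorphic_on half_strip"
    using pos by (intro holomorphic_intros) (auto simp: half_strip_def)
  show "Ln (1 + z) \<in> half_strip" if "z \<in> half_strip" for z
  proof -
    have "0 < Re z" using that by (simp add: half_strip_def)
    then have "1 < norm (1 + z)" using complex_Re_le_cmod[of "1 + z"] by simp
    moreover have "\<bar>Im (Ln (1 + z))\<bar> < pi / 2"
      using \<open>0 < Re z\<close> by (intro Re_Ln_pos_lt_imp) simp
    moreover have "1 + z \<noteq> 0" using \<open>1 < norm (1 + z)\<close> by auto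
    ultimately show ?thesis by (auto simp: half_strip_def)
  qed
  show "inj_on (\<lambda>z. Ln (1 + z)) half_strip"
  proof (rule inj_onI)
    fix z w assume *: "z \<in> half_strip" "w \<in> half_strip" "Ln (1 + z) = Ln (1 + w)"
    have "exp (Ln (1 + v)) = 1 + v" if "v \<in> half_strip" for v
      using that pos[of v] by (intro exp_Ln) (auto simp: half_strip_def)
    then show "z = w" using * by (metis add_left_imp_eq)
  qed
qed (auto simp: norm_Ln_one_plus_less)

interpretation left: petal "\<lambda>z. 1 - exp (- z)" "1 - fps_exp (- 1)" h "- 1"
proof
  show "fps_expansion h 0 $ 0 = (0::complex)" "fps_expansion h 0 $ 1 = (1::complex)"
    "fps_expansion h 0 $ 2 = (1 / 2::complex)"
    by (simp_all add: h_fps_expansion numeral_2_eq_2)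
  fix \<Phi> :: "complex fps"
  let ?F = "1 - fps_exp (- 1) :: complex fps" and ?H = "fps_exp 1 - 1 :: complex fps"
  let ?\<Psi> = "Abs_fps (\<lambda>n. (- 1) ^ Suc n * \<Phi> $ n)"
  assume \<Phi>: "\<Phi> $ 0 = 0" "\<Phi> oo ?F = ?F oo \<Phi>"
  \<comment> \<open>Conjugation by \<open>- X\<close> takes \<open>\<Phi>\<close> to
    \<open>?\<Psi>\<close> and \<open>?F\<close> to \<open>?H\<close>, hence preserves commutation;
    the remaining steps rewrite along this.\<close>
  have \<Psi>: "?\<Psi> = - (\<Phi> oo - fps_X)"
    by (simp add: fps_compose_uminus' fps_eq_iff)
  have H: "?H = - (?F oo - fps_X)"
    by (simp add: fps_compose_uminus' fps_eq_iff power_mult_distrib[symmetric])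
  have "(\<Phi> oo - fps_X) oo ?H = \<Phi> oo (- fps_X oo ?H)"
    by (rule fps_compose_assoc[symmetric]) auto
  then have 1: "?\<Psi> oo ?H = - (\<Phi> oo (- fps_X oo ?H))"
    by (simp only: \<Psi> fps_compose_uminus)
  have "fps_X oo ?H = ?H"
    by (rule fps_X_fps_compose_startby0) simp
  then have 2: "- fps_X oo ?H = ?F oo - fps_X"
    unfolding fps_compose_uminus by (simp only: H minus_minus)
  have "(?F oo - fps_X) oo ?\<Psi> = ?F oo (- fps_X oo ?\<Psi>)"
    by (rule fps_compose_assoc[symmetric]) (use \<Phi>(1) in auto)
  then have 3: "?H oo ?\<Psi> = - (?F oo (- fps_X oo ?\<Psi>))"
    unfolding H fps_compose_uminus by simp
  have "fps_X oo ?\<Psi> = ?\<Psi>"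
    by (rule fps_X_fps_compose_startby0) (use \<Phi>(1) in simp)
  then have 4: "- fps_X oo ?\<Psi> = \<Phi> oo - fps_X"
    unfolding fps_compose_uminus by (simp only: \<Psi> minus_minus)
  have "\<Phi> oo (?F oo - fps_X) = (\<Phi> oo ?F) oo - fps_X"
    by (rule fps_compose_assoc) auto
  also have "\<dots> = ?F oo (\<Phi> oo - fps_X)"
    unfolding \<Phi>(2) by (rule fps_compose_assoc[symmetric]) (use \<Phi>(1) in auto)
  finally show "?\<Psi> oo fps_expansion h 0 = fps_expansion h 0 oo ?\<Psi>"
    unfolding h_fps_expansion 1 2 3 4 by simp
next
  fix z :: complex assume "- 1 * z \<in> sector" "- 1 * h z \<in> sector"
  then show "attracting.A (- 1 * h z) = attracting.A (- 1 * z) - - 1"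
    using attracting.A_iter[of "- z" 1] sector_subset by (auto simp: h_def)
qed simp

interpretation right: petal "\<lambda>z. Ln (1 + z)" Ln_series h 1
proof
  show "fps_expansion h 0 $ 0 = (0::complex)" "fps_expansion h 0 $ 1 = (1::complex)"
    "fps_expansion h 0 $ 2 = (1 / 2::complex)"
    by (simp_all add: h_fps_expansion numeral_2_eq_2)
  fix \<Phi> :: "complex fps"
  let ?H = "fps_exp 1 - 1 :: complex fps"
  assume \<Phi>: "\<Phi> $ 0 = 0" "\<Phi> oo Ln_series = Ln_series oo \<Phi>"
  have "Ln_series oo ?H = fps_X"
    unfolding Ln_series_eq fps_ln_fps_exp_inv[of 1, simplified] by (rule fps_inv) auto
  \<comment> \<open>Commuting with the logarithm passes to its inverse: insert
    \<open>Ln_series oo ?H = X\<close> on the right and move the logarithm past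
    \<open>\<Phi>\<close>.\<close>
  then have "?H oo \<Phi> = (?H oo \<Phi>) oo (Ln_series oo ?H)"
    by simp
  also have "\<dots> = (?H oo (\<Phi> oo Ln_series)) oo ?H"
    using \<Phi>(1) Ln_series_0 by (simp add: fps_compose_assoc)
  also have "\<dots> = ((?H oo Ln_series) oo \<Phi>) oo ?H"
    unfolding \<Phi>(2) using \<Phi>(1) Ln_series_0 by (simp add: fps_compose_assoc)
  also have "\<dots> = \<Phi> oo ?H"
    using \<Phi>(1) by (simp add: exp_Ln_series)
  finally show "Abs_fps (\<lambda>n. 1 ^ Suc n * \<Phi> $ n) oo fps_expansion h 0 =
      fps_expansion h 0 oo Abs_fps (\<lambda>n. 1 ^ Suc n * \<Phi> $ n)"
    by (simp add: h_fps_expansion fps_nth_inverse)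
next
  fix z :: complex assume "1 * z \<in> sector" "1 * h z \<in> sector"
  \<comment> \<open>The bound \<open>|Im z| < pi\<close> lets the principal logarithm undo
    \<open>exp\<close>.\<close>
  moreover from this have "Ln (1 + h z) = z"
    by (auto simp: h_def sector_def abs_less_iff intro: Ln_exp)
  ultimately show "repelling.A (1 * h z) = repelling.A (1 * z) - 1"
    using repelling.A_iter[of "h z" 1] sector_subset by auto
qed simp

section \<open>The real sequences and uniqueness\<close>

lemma convergent_if_of_real_tendsto:
  assumes "(\<lambda>n. complex_of_real (s n)) \<longlonglongrightarrow> L"
  shows "convergent s" "L = of_real (lim s)"
proof -
  have "s \<longlonglongrightarrow> Re L" using tendsto_Re[OF assms] by simp
  then show "convergent s" by (rule convergentI)
  from \<open>s \<longlonglongrightarrow> Re L\<close> have "L = of_real (Re L)"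
    by (intro LIMSEQ_unique[OF assms] tendsto_of_real)
  then show "L = of_real (lim s)"
    using limI[OF \<open>s \<longlonglongrightarrow> Re L\<close>] by simp
qed

lemma iter_left: "((\<lambda>z. 1 - exp (- z)) ^^ n) (- complex_of_real x) = - of_real ((h ^^ n) x)"
proof (induction n)
  case (Suc n)
  then show ?case
    using exp_of_real[of "(h ^^ n) x", where ?'a = complex] by (simp add: h_def[of "(h ^^ n) x"])
qed simp

lemma h_iter_neg: "x < 0 \<Longrightarrow> (h ^^ n) x < (0::real)"
  by (induction n) (auto simp: h_def)

lemma h_inv_iter_pos: "0 < x \<Longrightarrow> 0 < (h_inv ^^ n) x"
  by (induction n) (auto simp: h_inv_def)

lemma iter_right:
  "0 < x \<Longrightarrow> ((\<lambda>z. Ln (1 + z)) ^^ n) (complex_of_real x) = of_real ((h_inv ^^ n) x)"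
proof (induction n)
  case (Suc n)
  have "0 < 1 + (h_inv ^^ n) x" using h_inv_iter_pos[OF Suc.prems, of n] by simp
  then have "Ln (of_real (1 + (h_inv ^^ n) x)) = of_real (ln (1 + (h_inv ^^ n) x))"
    by (rule Ln_of_real)
  then show ?case using Suc by (simp add: h_inv_def[of "(h_inv ^^ n) x"])
qed simp

lemma \<alpha>W1_limit:
  assumes "x < 0"
  shows "convergent (\<alpha>W1_seq x)" "left.\<alpha> (of_real x) = of_real (\<alpha>W1 x)"
proof -
  have "- complex_of_real x \<in> half_strip"
    using assms by (simp add: half_strip_def)
  from attracting.A_limit_log[OF this]
  have "(\<lambda>n. 2 / - of_real ((h ^^ n) x) - of_nat n - attracting.b * of_real (ln (real n)))
      \<longlonglongrightarrow> left.\<alpha> (of_real x)"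
    unfolding iter_left by (simp add: left.\<alpha>_def)
  moreover have "2 / - of_real ((h ^^ n) x) - of_nat n - attracting.b * of_real (ln (real n)) =
      complex_of_real (\<alpha>W1_seq x n)" for n
    by (simp add: attracting.b_def \<alpha>W1_seq_def fact_numeral)
  ultimately have "(\<lambda>n. complex_of_real (\<alpha>W1_seq x n)) \<longlonglongrightarrow> left.\<alpha> (of_real x)"
    by simp
  from convergent_if_of_real_tendsto[OF this]
  show "convergent (\<alpha>W1_seq x)" "left.\<alpha> (of_real x) = of_real (\<alpha>W1 x)"
    by (auto simp: \<alpha>W1_def)
qed

text \<open>Compared with the negative axis, both \<open>b\<close> and the sign in front of
  \<open>A\<close> are reversed, so \<open>- (1/3) ln n\<close> appears in both sequences.\<close>

lemma \<alpha>W2_limit: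
  assumes "0 < x"
  shows "convergent (\<alpha>W2_seq x)" "right.\<alpha> (of_real x) = of_real (\<alpha>W2 x)"
proof -
  have b: "repelling.b = - 1 / 3"
    unfolding repelling.b_def by (simp add: Ln_series_eq fps_ln_nth)
  have "complex_of_real x \<in> half_strip"
    using assms by (simp add: half_strip_def)
  from tendsto_minus[OF repelling.A_limit_log[OF this]]
  have "(\<lambda>n. - (2 / of_real ((h_inv ^^ n) x) - of_nat n - repelling.b * of_real (ln (real n))))
      \<longlonglongrightarrow> right.\<alpha> (of_real x)"
    unfolding iter_right[OF assms] by (simp add: right.\<alpha>_def)
  moreover have "- (2 / of_real ((h_inv ^^ n) x) - of_nat n - repelling.b * of_real (ln (real n))) =
      complex_of_real (\<alpha>W2_seq x n)" for n
    by (simp add: b \<alpha>W2_seq_def)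
  ultimately have "(\<lambda>n. complex_of_real (\<alpha>W2_seq x n)) \<longlonglongrightarrow> right.\<alpha> (of_real x)"
    by simp
  from convergent_if_of_real_tendsto[OF this]
  show "convergent (\<alpha>W2_seq x)" "right.\<alpha> (of_real x) = of_real (\<alpha>W2 x)"
    by (auto simp: \<alpha>W2_def)
qed

lemma regular_abel_\<alpha>W1: "regular_abel_function_real h {..<0} \<alpha>W1"
  unfolding regular_abel_function_real_def
  using left.regular_abel_\<alpha> \<alpha>W1_limit(2) of_real_in_sector
  by (intro exI[of _ left.D] exI[of _ left.\<alpha>]) (auto simp: left.D_def simp flip: of_real_minus)

lemma regular_abel_\<alpha>W2: "regular_abel_function_real h {0<..} \<alpha>W2"
  unfolding regular_abel_function_real_def
  using right.regular_abel_\<alpha> \<alpha>W2_limit(2) of_real_in_sector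
  by (intro exI[of _ right.D] exI[of _ right.\<alpha>]) (auto simp: right.D_def)

text \<open>By the Abel equation the difference of \<open>\<beta>\<close> stays constant along the
  orbits of two points, which is the input of \<open>regular_abel_increment\<close>; so
  \<open>a\<close> and \<open>\<alpha>W1\<close> have equal increments.\<close>

lemma \<alpha>W1_unique:
  assumes "regular_abel_function_real h {..<0} a"
  obtains c where "\<And>x. x < 0 \<Longrightarrow> a x = \<alpha>W1 x + c"
proof -
  obtain E \<beta> where E: "regular_abel_function h E \<beta>" "complex_of_real ` {..<0} \<subseteq> E"
    and \<beta>: "\<And>x. x < 0 \<Longrightarrow> \<beta> (of_real x) = of_real (a x)"
    using assms unfolding regular_abel_function_real_def by auto
  have inE: "of_real x \<in> E" if "x < 0" for x
    using E(2) that by auto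
  have step: "\<beta> (of_real (h x)) = \<beta> (of_real x) + 1" if "x < 0" for x
  proof -
    have "\<forall>z\<in>E. h z \<in> E \<longrightarrow> \<beta> (h z) = \<beta> z + 1"
      using E(1) by (simp add: regular_abel_function_def)
    from bspec[OF this inE[OF that]] show ?thesis
      using inE[of "h x"] h_iter_neg[OF that, of 1] by (simp add: h_of_real)
  qed
  have orb: "\<beta> (of_real ((h ^^ n) x)) = \<beta> (of_real x) + of_nat n" if "x < 0" for x n
    using step[OF h_iter_neg[OF that]] by (induction n) auto
  have "a x - a y = \<alpha>W1 x - \<alpha>W1 y" if "x < 0" "y < 0" for x y
  proof -
    have "left.\<alpha> (of_real x) - left.\<alpha> (of_real y) = \<beta> (of_real x) - \<beta> (of_real y)"
      by (rule left.regular_abel_increment[OF E(1)])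
        (use that orb inE h_iter_neg in \<open>auto simp: half_strip_def iter_left\<close>)
    then have "complex_of_real (\<alpha>W1 x - \<alpha>W1 y) = complex_of_real (a x - a y)"
      using that by (simp add: \<beta> \<alpha>W1_limit)
    then show ?thesis by (simp only: of_real_eq_iff)
  qed
  then show ?thesis
    using that[of "a (- 1) - \<alpha>W1 (- 1)"] by (smt (verit))
qed

text \<open>The orbits tending to 0 are now those of \<open>h_inv\<close>, along which
  \<open>\<beta>\<close> loses 1 per step; differences between two orbits are again
  constant.\<close>

lemma \<alpha>W2_unique:
  assumes "regular_abel_function_real h {0<..} a"
  obtains c where "\<And>x. 0 < x \<Longrightarrow> a x = \<alpha>W2 x + c"
proof -
  obtain E \<beta> where E: "regular_abel_function h E \<beta>" "complex_of_real ` {0<..} \<subseteq> E"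
    and \<beta>: "\<And>x. 0 < x \<Longrightarrow> \<beta> (of_real x) = of_real (a x)"
    using assms unfolding regular_abel_function_real_def by auto
  have inE: "of_real x \<in> E" if "0 < x" for x
    using E(2) that by auto
  have step: "\<beta> (of_real (h_inv x)) = \<beta> (of_real x) - 1" if "0 < x" for x
  proof -
    have "h (complex_of_real (h_inv x)) = of_real x"
      unfolding h_of_real using that by (simp add: h_def h_inv_def)
    then show ?thesis
      using E(1) inE[of x] inE[of "h_inv x"] that h_inv_iter_pos[of x 1]
      unfolding regular_abel_function_def by (metis add_diff_cancel_right' funpow_0 funpow_simps_right(2) o_apply One_nat_def)
  qed
  have orb: "\<beta> (of_real ((h_inv ^^ n) x)) = \<beta> (of_real x) - of_nat n" if "0 < x" for x n
    using step[OF h_inv_iter_pos[OF that]] by (induction n) auto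
  have "a x - a y = \<alpha>W2 x - \<alpha>W2 y" if "0 < x" "0 < y" for x y
  proof -
    have "right.\<alpha> (of_real x) - right.\<alpha> (of_real y) = \<beta> (of_real x) - \<beta> (of_real y)"
      by (rule right.regular_abel_increment[OF E(1)])
        (use that orb inE h_inv_iter_pos in \<open>auto simp: half_strip_def iter_right\<close>)
    then have "complex_of_real (\<alpha>W2 x - \<alpha>W2 y) = complex_of_real (a x - a y)"
      using that by (simp add: \<beta> \<alpha>W2_limit)
    then show ?thesis by (simp only: of_real_eq_iff)
  qed
  then show ?thesis
    using that[of "a 1 - \<alpha>W2 1"] by (smt (verit))
qed

theorem theorem5:
  shows "(\<forall>z<0. convergent (\<alpha>W1_seq z)) \<and>
         regular_abel_function_real h {..<0} \<alpha>W1 \<and>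
         (\<forall>a. regular_abel_function_real h {..<0} a \<longrightarrow> (\<exists>c. \<forall>z<0. a z = \<alpha>W1 z + c)) \<and>
         (\<forall>z>0. convergent (\<alpha>W2_seq z)) \<and>
         regular_abel_function_real h {0<..} \<alpha>W2 \<and>
         (\<forall>a. regular_abel_function_real h {0<..} a \<longrightarrow> (\<exists>c. \<forall>z>0. a z = \<alpha>W2 z + c))"
proof (intro conjI allI impI)
  fix a
  show "\<exists>c. \<forall>z<0. a z = \<alpha>W1 z + c" if "regular_abel_function_real h {..<0} a"
    using \<alpha>W1_unique[OF that] by metis
  show "\<exists>c. \<forall>z>0. a z = \<alpha>W2 z + c" if "regular_abel_function_real h {0<..} a"
    using \<alpha>W2_unique[OF that] by metis
qed (use \<alpha>W1_limit(1) \<alpha>W2_limit(1) regular_abel_\<alpha>W1 regular_abel_\<alpha>W2 in auto)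

end
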